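(* Let $0<b_1<b_2<1$, let $\mathcal C\subset\mathbb Z\times\mathbb Z_{\ge0}$, and let $\mathbb P^{b_1,b_2}$ be the law of the $\mathcal C$-censored (shifted) stochastic six-vertex process $(\eta_t)_{t\ge0}$ with parameters $b_1,b_2$ started from $\eta_0=\mathbf 1_{x>0}$. Let $\mathbb P^{b_2,b_1}$ (with expectation $\mathbb E^{b_2,b_1}$) be the law of the same process with the parameters $b_1$ and $b_2$ exchanged. Then for every time $t\in\mathbb Z_{\ge 0}$ and every partition $\mu$, $$\mathbb P^{b_1,b_2}(\eta_t=\mu)=\mathbb E^{b_2,b_1}\big(v_{\eta_t}(\mu)\big),$$ where particle configurations in $A$ are identified with partitions and $v_\lambda$ is defined with $q=b_1/b_2$.
   Context: Stochastic six-vertex model with parameters $(b_1,b_2)$. Vertices are $(x,t)\in\mathbb Z\times\mathbb Z_{\ge0}$. Each vertex has two incoming edges (from the left and from below) and two outgoing edges (to the right and upwards); each edge is either occupied by a path or empty. Given $\eta_0:\mathbb Z\to\{0,1\}$ with $\eta_0(x)=0$ for all sufficiently negative $x$, the edge below $(x,0)$ is occupied iff $\eta_0(x)=1$, and no path comes in from $-\infty$ horizontally. The configuration is sampled line by line ($t=0,1,2,\dots$), on each line from left to right, with independent choices: - if both incoming edges are occupied (resp. empty), both outgoing edges are occupied (resp. empty); - if only the edge from below is occupied, then with probability $b_1$ the path goes straight (up) and with probability $1-b_1$ it turns (right); - if only the edge from the left is occupied, then with probability $b_2$ the path goes straight (right) and with probability $1-b_2$ it turns (up). The (shifted) process is $\eta_t(x)=1$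 if the edge below $(x+t,t)$ is occupied, $\eta_t(x)=0$ otherwise. The $\mathcal C$-censored process has the same dynamics, except that at vertices in $\mathcal C$ at which exactly one incoming edge is occupied the path always turns. Exchanging the parameters means using $b_2$ in place of $b_1$ and $b_1$ in place of $b_2$ in these rules. Let $A=\{\eta:\mathbb Z\to\{0,1\}:\sum_{x\le 0}\eta(x)=\sum_{x\ge1}(1-\eta(x))<\infty\}$. A configuration $\eta\in A$ with particles at ordered positions $X_1<X_2<\cdots$ is identified with the partition $\lambda$ given by $\lambda_i=i-X_i$; so $\mathbf 1_{x>0}$ corresponds to the empty partition $()$. Partitions are identified with Young diagrams $\{(i,j)\in\mathbb Z_{\ge1}^2:j\le\lambda_i\}$, $|\lambda|=\sum_i\lambda_i$, and $\mu\le\lambda$ means $\mu_i\le\lambda_i$ for all $i$. The rim of a partition $\lambda$ is its maximal ribbon (skew shape $\lambda/\mu$ containing no $2\times2$ square), i.e. the set of boxes $(i,j)\in\lambda$ with $(i+1,j+1)\notin\lambda$. Successively removing rims gives $\lambda=\lambda^{(1)}\ge\lambda^{(2)}\ge\cdots\ge()$ with $\lambda^{(k)}/\lambda^{(k+1)}$ the rim of $\lambda^{(k)}$. For $\mu\le\lambda$, $$v_\lambda(\mu)=q^{|\mu|}\prod_{k\ge1}(1-q^k)^{n_k},$$ where $n_k$ is the number of connected components (boxes adjacent iff they share an edge) of the rim $\lambda^{(k)}/\lambda^{(k+1)}$ after all boxes of $\mu$ are removed (equivalently of $\lambda^{(k)}$ with the boxes of $\mu$ removed); $v_\lambda(\mu)=0$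 if $\mu\not\le\lambda$. *)

theory Defs
  imports "HOL-Probability.Probability"
begin

section \<open>The censored stochastic six-vertex process\<close>

text \<open>
  A line of vertical edges is a map \<open>int \<Rightarrow> bool\<close>, \<open>True\<close> meaning occupied.
  Every vertex carries a pair of coins \<open>(s, s')\<close>: the path goes straight iff \<open>s\<close> when it comes in
  from below only, and iff \<open>s'\<close> when it comes in from the left only.
\<close>

type_synonym config = "int \<Rightarrow> bool"

type_synonym coins = "int \<times> nat \<Rightarrow> bool \<times> bool"

fun up_out :: "bool \<Rightarrow> bool \<Rightarrow> bool \<times> bool \<Rightarrow> bool" where
  "up_out below left (s, s') =
     (if below = left then below else if below then s else \<not> s')"

fun right_out :: "bool \<Rightarrow> bool \<Rightarrow> bool \<times> bool \<Rightarrow> bool" where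
  "right_out below left (s, s') =
     (if below = left then below else if below then \<not> s else s')"

text \<open>
  \<open>left_from V s m n\<close> is the edge entering vertex \<open>m + n\<close> from the left if no path enters vertex
  \<open>m\<close> from the left; here \<open>V\<close> is the line of edges from below and \<open>s\<close> the coins of the line.
\<close>

primrec left_from :: "config \<Rightarrow> (int \<Rightarrow> bool \<times> bool) \<Rightarrow> int \<Rightarrow> nat \<Rightarrow> bool" where
  "left_from V s m 0 = False"
| "left_from V s m (Suc n) =
     right_out (V (m + int n)) (left_from V s m n) (s (m + int n))"

text \<open>
  If \<open>V\<close> is empty to the left of \<open>m\<close> and no path comes in from \<open>-\<infinity>\<close>, then no path enters \<open>m\<close> from
  the left. The result does not depend on which such \<open>m\<close> is used. If \<open>V\<close> has particles arbitrarily
  far to the left, no such \<open>m\<close> exists and the value is meaningless.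
\<close>

definition left_edge :: "config \<Rightarrow> (int \<Rightarrow> bool \<times> bool) \<Rightarrow> int \<Rightarrow> bool" where
  "left_edge V s x \<longleftrightarrow> (\<exists>m\<le>x. (\<forall>y<m. \<not> V y) \<and> left_from V s m (nat (x - m)))"

lemma left_from_shift:
  assumes "\<forall>y<m + int k. \<not> V y"
  shows "\<not> left_from V s m k" "left_from V s m (k + n) = left_from V s (m + int k) n"
proof -
  have "\<not> left_from V s m j" if "j \<le> k" for j
    using that assms by (induction j) (auto, metis right_out.simps surj_pair)
  then show *: "\<not> left_from V s m k" by simp
  show "left_from V s m (k + n) = left_from V s (m + int k) n"
    by (induction n) (auto simp: * add.assoc)
qed

lemma left_edge_rec:
  assumes "\<exists>m. \<forall>y<m. \<not> V y"
  shows "left_edge V s (x + 1) = right_out (V x) (left_edge V s x) (s x)"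
    and "\<exists>m. \<forall>y<m. \<not> left_edge V s y"
proof -
  have indep: "left_edge V s x = left_from V s m (nat (x - m))"
    if m: "\<forall>y<m. \<not> V y" "m \<le> x" for m x
  proof -
    have "left_from V s m (nat (x - m)) = left_from V s m' (nat (x - m'))"
      if "m \<le> m'" "m' \<le> x" "\<forall>y<m'. \<not> V y" for m m'
      using left_from_shift(2)[of m "nat (m' - m)" V s "nat (x - m')"] that
      by (simp flip: nat_add_distrib)
    then show ?thesis
      unfolding left_edge_def using m by (metis linear)
  qed
  obtain m where m: "\<forall>y<m. \<not> V y" using assms by blast
  define m' where "m' = min m x"
  have m': "\<forall>y<m'. \<not> V y" "m' \<le> x" using m by (auto simp: m'_def)
  have "nat (x + 1 - m') = Suc (nat (x - m'))" using m' by simp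
  then show "left_edge V s (x + 1) = right_out (V x) (left_edge V s x) (s x)"
    using indep[OF m'(1), of x] indep[OF m'(1), of "x + 1"] m' by simp
  have "\<not> left_edge V s y" if "y < m" for y
    using indep[of y y] m that by auto
  then show "\<exists>m. \<forall>y<m. \<not> left_edge V s y" by blast
qed

text \<open>Censoring forces both coins to ``turn''.\<close>

definition censor :: "(int \<times> nat) set \<Rightarrow> coins \<Rightarrow> coins" where
  "censor C \<omega> v = (if v \<in> C then (False, False) else \<omega> v)"

text \<open>\<open>below_edge C \<eta>0 \<omega> t x\<close> is the edge below the vertex \<open>(x, t)\<close>.\<close>

primrec below_edge :: "(int \<times> nat) set \<Rightarrow> config \<Rightarrow> coins \<Rightarrow> nat \<Rightarrow> config" where
  "below_edge C \<eta>0 \<omega> 0 = \<eta>0"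
| "below_edge C \<eta>0 \<omega> (Suc t) =
     (\<lambda>x. up_out (below_edge C \<eta>0 \<omega> t x)
                 (left_edge (below_edge C \<eta>0 \<omega> t) (\<lambda>y. censor C \<omega> (y, t)) x)
                 (censor C \<omega> (x, t)))"

definition six_vertex :: "(int \<times> nat) set \<Rightarrow> config \<Rightarrow> coins \<Rightarrow> nat \<Rightarrow> config" where
  "six_vertex C \<eta>0 \<omega> t x = below_edge C \<eta>0 \<omega> t (x + int t)"

definition coin_measure :: "real \<Rightarrow> real \<Rightarrow> coins measure" where
  "coin_measure b1 b2 =
     (\<Pi>\<^sub>M v\<in>UNIV. measure_pmf (pair_pmf (bernoulli_pmf b1) (bernoulli_pmf b2)))"

definition step_config :: config where
  "step_config x \<longleftrightarrow> x > 0"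


section \<open>Configurations and partitions\<close>

definition configs_A :: "config set" where
  "configs_A = {\<eta>. finite {x. x \<le> 0 \<and> \<eta> x} \<and> finite {x. x \<ge> 1 \<and> \<not> \<eta> x} \<and>
                    card {x. x \<le> 0 \<and> \<eta> x} = card {x. x \<ge> 1 \<and> \<not> \<eta> x}}"

text \<open>
  Partitions are functions on the indices \<open>i \<ge> 1\<close>; the value at the unused index \<open>0\<close> is
  normalised to \<open>0\<close>, so that equality of functions is equality of partitions.
\<close>

definition is_partition :: "(nat \<Rightarrow> nat) \<Rightarrow> bool" where
  "is_partition lam \<longleftrightarrow> lam 0 = 0 \<and> (\<forall>i\<ge>1. lam (Suc i) \<le> lam i) \<and> finite {i. lam i \<noteq> 0}"

text \<open>The \<open>i\<close>-th particle from the left, \<open>i \<ge> 1\<close>.\<close>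

definition particle :: "config \<Rightarrow> nat \<Rightarrow> int" where
  "particle \<eta> i = (THE x. \<eta> x \<and> card {y. y \<le> x \<and> \<eta> y} = i)"

text \<open>For \<open>\<eta> \<in> configs_A\<close> one has \<open>particle \<eta> i \<le> i\<close>, so \<open>nat\<close> does not truncate.\<close>

definition partition_of :: "config \<Rightarrow> nat \<Rightarrow> nat" where
  "partition_of \<eta> i = (if i = 0 then 0 else nat (int i - particle \<eta> i))"


section \<open>The weights\<close>

definition young :: "(nat \<Rightarrow> nat) \<Rightarrow> (nat \<times> nat) set" where
  "young lam = {(i, j). 1 \<le> i \<and> 1 \<le> j \<and> j \<le> lam i}"

definition partition_size :: "(nat \<Rightarrow> nat) \<Rightarrow> nat" where
  "partition_size lam = (\<Sum>i | lam i \<noteq> 0. lam i)"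

definition rim :: "(nat \<times> nat) set \<Rightarrow> (nat \<times> nat) set" where
  "rim D = {(i, j). (i, j) \<in> D \<and> (i + 1, j + 1) \<notin> D}"

text \<open>\<open>k\<close> counts the removed rims, so the partition with index \<open>k \<ge> 1\<close> in the sequence is \<open>peel lam (k - 1)\<close>.\<close>

definition peel :: "(nat \<Rightarrow> nat) \<Rightarrow> nat \<Rightarrow> (nat \<times> nat) set" where
  "peel lam k = ((\<lambda>D. D - rim D) ^^ k) (young lam)"

definition adjacent :: "nat \<times> nat \<Rightarrow> nat \<times> nat \<Rightarrow> bool" where
  "adjacent p p' \<longleftrightarrow>
     (fst p = fst p' \<and> (snd p' = snd p + 1 \<or> snd p = snd p' + 1)) \<or>
     (snd p = snd p' \<and> (fst p' = fst p + 1 \<or> fst p = fst p' + 1))"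

definition components :: "(nat \<times> nat) set \<Rightarrow> (nat \<times> nat) set set" where
  "components S = S // {(p, p'). p \<in> S \<and> p' \<in> S \<and> adjacent p p'}\<^sup>*"

definition n_comp :: "(nat \<Rightarrow> nat) \<Rightarrow> (nat \<Rightarrow> nat) \<Rightarrow> nat \<Rightarrow> nat" where
  "n_comp lam \<mu> k = card (components (rim (peel lam (k - 1)) - young \<mu>))"

text \<open>For partitions, only finitely many \<open>n_comp lam \<mu> k\<close> are nonzero; the other factors are \<open>1\<close>.\<close>

definition v_weight :: "real \<Rightarrow> (nat \<Rightarrow> nat) \<Rightarrow> (nat \<Rightarrow> nat) \<Rightarrow> real" where
  "v_weight q lam \<mu> =
     (if \<forall>i. \<mu> i \<le> lam i
      then q ^ partition_size \<mu> *
           (\<Prod>k | k \<ge> 1 \<and> n_comp lam \<mu> k \<noteq> 0. (1 - q ^ k) ^ n_comp lam \<mu> k)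
      else 0)"

text \<open>
  The process started from \<open>step_config\<close> is in \<open>configs_A\<close> only almost surely; on the
  exceptional null event there is no associated partition and the weight is set to \<open>0\<close>.
\<close>

definition v_config :: "real \<Rightarrow> config \<Rightarrow> (nat \<Rightarrow> nat) \<Rightarrow> real" where
  "v_config q \<eta> \<mu> = (if \<eta> \<in> configs_A then v_weight q (partition_of \<eta>) \<mu> else 0)"

end

theory Submission
  imports Defs "HOL-Combinatorics.Transposition"
begin

text \<open>
  In shifted coordinates the vertex \<open>(x, t)\<close> acts only on the sites \<open>x - t - 1\<close> and \<open>x - t\<close>:
  a particle-hole pair is swapped with probability \<open>b2\<close>, a hole-particle pair with probability \<open>b1\<close>,
  and censoring a vertex replaces its action by the identity. Let \<open>d\<close> be the difference of the
  height functions (numbers of particles weakly to the left) of \<open>\<lambda>\<close> and \<open>\<mu>\<close>; it counts the boxes of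
  \<open>\<lambda> / \<mu>\<close> on each diagonal. The components of the \<open>k\<close>-th rim outside \<open>\<mu>\<close> are the maximal intervals
  on which \<open>d \<ge> k\<close>, so counting them by the up-steps of \<open>d\<close> gives the local product formula
  \<open>v\<^sub>\<lambda>(\<mu>) = q\<^bsup>|\<mu>|\<^esup> \<Prod> (1 - q\<^bsup>d(x)\<^esup>)\<close> over all \<open>x\<close> that carry a particle of \<open>\<lambda>\<close> but not of \<open>\<mu>\<close>.
  With it, a check on two sites shows that the action of a vertex with exchanged parameters
  on \<open>\<lambda>\<close> in \<open>v\<^sub>\<lambda>(\<mu>)\<close> equals the dual action of the vertex with the original parameters on \<open>\<mu>\<close>.
  Hence the identity propagates vertex by vertex.
\<close>

section \<open>Height functions and partitions\<close>

text \<open>\<open>card\<close> gives 0 on infinite sets, so this is the particle count only where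
  the configuration is empty far to the left, as members of \<open>configs_A\<close> are.\<close>

definition cfg_height :: "config \<Rightarrow> int \<Rightarrow> nat" where
  "cfg_height \<eta> x = card {y. y \<le> x \<and> \<eta> y}"

definition swap_sites :: "int \<Rightarrow> config \<Rightarrow> config" where
  "swap_sites k \<eta> = \<eta> \<circ> Transposition.transpose k (k + 1)"

lemma finite_below:
  fixes \<eta> :: config
  assumes "\<forall>y\<le>m. \<not> \<eta> y"
  shows "finite {y. y \<le> x \<and> \<eta> y}"
proof (rule finite_subset)
  show "{y. y \<le> x \<and> \<eta> y} \<subseteq> {m..x}" 
  proof
    fix y assume "y \<in> {y. y \<le> x \<and> \<eta> y}"
    then have "\<not> y \<le> m" "y \<le> x" using assms by auto
    then show "y \<in> {m..x}" by simp
  qed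
qed simp

lemma cfg_height_step:
  assumes "\<forall>y\<le>m. \<not> \<eta> y"
  shows "cfg_height \<eta> x = cfg_height \<eta> (x - 1) + of_bool (\<eta> x)"
proof (cases "\<eta> x")
  case True
  then have "{y. y \<le> x \<and> \<eta> y} = insert x {y. y \<le> x - 1 \<and> \<eta> y}" by auto
  then show ?thesis using True finite_below[OF assms, of "x - 1"] by (simp add: cfg_height_def)
next
  case False
  then have "{y. y \<le> x \<and> \<eta> y} = {y. y \<le> x - 1 \<and> \<eta> y}" by (auto simp: order_le_less)
  then show ?thesis using False by (simp add: cfg_height_def)
qed

lemma cfg_height_mono:
  assumes "\<forall>y\<le>m. \<not> \<eta> y" "x \<le> y"
  shows "cfg_height \<eta> x \<le> cfg_height \<eta> y"
  unfolding cfg_height_def using assms(2) by (intro card_mono finite_below[OF assms(1)]) auto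

lemma cfg_height_eq_0:
  assumes "\<forall>y\<le>m. \<not> \<eta> y" "x \<le> m"
  shows "cfg_height \<eta> x = 0"
proof -
  have empty: "{y. y \<le> x \<and> \<eta> y} = {}" using assms by auto
  show ?thesis unfolding cfg_height_def empty by simp
qed

text \<open>Particles and holes on [1, x] together number \<open>x\<close>. This turns the balance
  condition of \<open>configs_A\<close> into the asymptotics of the height function.\<close>

lemma cfg_height_eq_card_diff:
  assumes "finite {y. y \<le> 0 \<and> \<eta> y}" "x \<ge> 0"
  shows "cfg_height \<eta> x + card {y. 1 \<le> y \<and> y \<le> x \<and> \<not> \<eta> y} = card {y. y \<le> 0 \<and> \<eta> y} + nat x"
proof -
  have "{y. y \<le> x \<and> \<eta> y} = {y. y \<le> 0 \<and> \<eta> y} \<union> {y. 1 \<le> y \<and> y \<le> x \<and> \<eta> y}"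
    using assms(2) by auto
  moreover have f: "finite {y. 1 \<le> y \<and> y \<le> x \<and> P y}" for P
    by (rule finite_subset[of _ "{1..x}"]) auto
  ultimately have "cfg_height \<eta> x = card {y. y \<le> 0 \<and> \<eta> y} + card {y. 1 \<le> y \<and> y \<le> x \<and> \<eta> y}"
    unfolding cfg_height_def using assms(1) by (simp only:, subst card_Un_disjoint) auto
  moreover have "{1..x} = {y. 1 \<le> y \<and> y \<le> x \<and> \<eta> y} \<union> {y. 1 \<le> y \<and> y \<le> x \<and> \<not> \<eta> y}" by auto
  then have "card {1..x} = card {y. 1 \<le> y \<and> y \<le> x \<and> \<eta> y} + card {y. 1 \<le> y \<and> y \<le> x \<and> \<not> \<eta> y}"
    using f by (simp only:, subst card_Un_disjoint) auto
  ultimately show ?thesis using assms(2) by simp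
qed

text \<open>\<open>nat x\<close> is the height of the step configuration. For
  \<open>x \<ge> 0\<close> the deviation from it is the number of holes beyond \<open>x\<close>,
  hence never negative, and zero once \<open>x\<close> is past every hole.\<close>

lemma configs_A_D:
  assumes "\<eta> \<in> configs_A"
  obtains m :: nat where "\<forall>y\<le>- int m. \<not> \<eta> y" "\<forall>y>int m. \<eta> y"
    "\<And>x. x \<le> - int m \<or> int m \<le> x \<Longrightarrow> cfg_height \<eta> x = nat x"
    "\<And>x. nat x \<le> cfg_height \<eta> x"
proof -
  let ?P = "{x. x \<le> 0 \<and> \<eta> x}" and ?H = "{x. x \<ge> 1 \<and> \<not> \<eta> x}"
  have fin: "finite ?P" "finite ?H" and cards: "card ?P = card ?H"
    using assms by (auto simp: configs_A_def)
  define m where "m = nat (Max ((\<lambda>x. \<bar>x\<bar>) ` (insert 0 (?P \<union> ?H))) + 1)"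
  have "\<bar>x\<bar> \<le> Max ((\<lambda>x. \<bar>x\<bar>) ` (insert 0 (?P \<union> ?H)))" if "x \<in> insert 0 (?P \<union> ?H)" for x
    using fin that by (intro Max_ge) auto
  then have m: "\<bar>x\<bar> < int m" if "x \<in> insert 0 (?P \<union> ?H)" for x
    using that unfolding m_def by fastforce
  have low: "\<forall>y\<le>- int m. \<not> \<eta> y"
  proof (intro allI impI notI)
    fix y assume y: "y \<le> - int m" "\<eta> y"
    then have "y \<in> ?P" using m[of 0] by auto
    then show False using m[of y] y by auto
  qed
  have high: "\<forall>y>int m. \<eta> y"
  proof (intro allI impI, rule ccontr)
    fix y assume y: "y > int m" "\<not> \<eta> y"
    then have "y \<in> ?H" using m[of 0] by auto
    then show False using m[of y] y by auto
  qed
  have holes_sub: "{y. 1 \<le> y \<and> y \<le> x \<and> \<not> \<eta> y} \<subseteq> ?H" for x by auto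
  have ge: "nat x \<le> cfg_height \<eta> x" for x
  proof (cases "x \<ge> 0")
    case True
    show ?thesis
      using cfg_height_eq_card_diff[OF fin(1) True] card_mono[OF fin(2) holes_sub[of x]] cards by simp
  qed simp
  have "cfg_height \<eta> x = nat x" if "x \<le> - int m \<or> int m \<le> x" for x
  proof (cases "x \<ge> 0")
    case True
    then have "int m \<le> x" using that m[of 0] by auto
    then have "{y. 1 \<le> y \<and> y \<le> x \<and> \<not> \<eta> y} = ?H" using m by fastforce
    then show ?thesis using cfg_height_eq_card_diff[OF fin(1) True] cards by simp
  next
    case False
    then show ?thesis using that cfg_height_eq_0[OF low] by auto
  qed
  then show ?thesis using that low high ge by blast
qed

text \<open>Converse criterion: emptiness far to the left bounds the particles at nonpositive sites,
  and height \<open>nat x\<close> far to the right both forces full occupation there and balances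
  particles against holes.\<close>

lemma configs_A_I:
  assumes low: "\<forall>y\<le>m. \<not> \<eta> y" and high: "\<forall>x\<ge>M. cfg_height \<eta> x = nat x"
  shows "\<eta> \<in> configs_A"
proof -
  define M' where "M' = max 0 M"
  have hM: "cfg_height \<eta> x = nat x" if "x \<ge> M'" for x using that high by (simp add: M'_def)
  have finP: "finite {x. x \<le> 0 \<and> \<eta> x}" by (rule finite_below[OF low])
  have "\<eta> x" if "x > M'" for x
    using cfg_height_step[OF low, of x] hM[of x] hM[of "x - 1"] that
    by (cases "\<eta> x") (auto simp: M'_def)
  then have H: "{x. x \<ge> 1 \<and> \<not> \<eta> x} = {y. 1 \<le> y \<and> y \<le> M' \<and> \<not> \<eta> y}" by force
  have "finite {x. x \<ge> 1 \<and> \<not> \<eta> x}" unfolding H by (rule finite_subset[of _ "{1..M'}"]) auto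
  moreover have "card {x. x \<ge> 1 \<and> \<not> \<eta> x} = card {x. x \<le> 0 \<and> \<eta> x}"
    unfolding H using cfg_height_eq_card_diff[OF finP, of M'] hM[of M'] by (simp add: M'_def)
  ultimately show ?thesis using finP by (simp add: configs_A_def)
qed

text \<open>A member is determined by two finite sets of integers. Countability later makes every
  functional supported on \<open>configs_A\<close> measurable.\<close>

lemma countable_configs_A: "countable configs_A"
proof -
  let ?f = "\<lambda>\<eta> :: config. ({x. x \<le> 0 \<and> \<eta> x}, {x. x \<ge> 1 \<and> \<not> \<eta> x})"
  have "inj_on ?f configs_A"
  proof (rule inj_onI, rule ext)
    fix \<eta> \<zeta> :: config and x assume "?f \<eta> = ?f \<zeta>"
    then have "x \<in> fst (?f \<eta>) \<longleftrightarrow> x \<in> fst (?f \<zeta>)" "x \<in> snd (?f \<eta>) \<longleftrightarrow> x \<in> snd (?f \<zeta>)" by auto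
    then show "\<eta> x = \<zeta> x" by (cases "x \<le> 0") auto
  qed
  moreover have "?f ` configs_A \<subseteq> Collect finite \<times> Collect finite"
    by (auto simp: configs_A_def)
  then have "countable (?f ` configs_A)"
    by (rule countable_subset) (intro countable_SIGMA countable_Collect_finite)
  ultimately show ?thesis by (rule countable_image_inj_on[rotated])
qed

section \<open>Exchanging the contents of two neighbouring sites\<close>

lemma swap_sites_apply:
  "swap_sites k \<eta> x = (if x = k then \<eta> (k + 1) else if x = k + 1 then \<eta> k else \<eta> x)"
  by (simp add: swap_sites_def Transposition.transpose_def)

lemma swap_swap [simp]: "swap_sites k (swap_sites k \<eta>) = \<eta>"
  by (simp add: swap_sites_def fun_eq_iff)

lemma swap_sites_eq: "\<eta> k = \<eta> (k + 1) \<Longrightarrow> swap_sites k \<eta> = \<eta>"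
  by (auto simp: swap_sites_apply fun_eq_iff)

text \<open>For \<open>x \<noteq> k\<close> the sites \<open>k\<close> and \<open>k + 1\<close> lie
  on the same side of the cut after \<open>x\<close>, so the transposition maps the counted
  particles bijectively.\<close>

lemma cfg_height_swap_sites:
  assumes "x \<noteq> k"
  shows "cfg_height (swap_sites k \<eta>) x = cfg_height \<eta> x"
proof -
  have "{y. y \<le> x \<and> swap_sites k \<eta> y} = Transposition.transpose k (k + 1) ` {y. y \<le> x \<and> \<eta> y}"
  proof (intro equalityI subsetI)
    fix y assume "y \<in> {y. y \<le> x \<and> swap_sites k \<eta> y}"
    then have "Transposition.transpose k (k + 1) y \<in> {y. y \<le> x \<and> \<eta> y}"
      using assms by (auto simp: swap_sites_def Transposition.transpose_def split: if_splits)
    then show "y \<in> Transposition.transpose k (k + 1) ` {y. y \<le> x \<and> \<eta> y}"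
      by (metis (no_types, lifting) imageI transpose_involutory)
  next
    fix y assume "y \<in> Transposition.transpose k (k + 1) ` {y. y \<le> x \<and> \<eta> y}"
    then show "y \<in> {y. y \<le> x \<and> swap_sites k \<eta> y}"
      using assms by (auto simp: swap_sites_def Transposition.transpose_def split: if_splits)
  qed
  then show ?thesis by (simp add: cfg_height_def card_image)
qed

lemma swap_sites_in_configs_A:
  assumes "\<eta> \<in> configs_A"
  shows "swap_sites k \<eta> \<in> configs_A"
proof -
  obtain m :: nat where m: "\<forall>y\<le>- int m. \<not> \<eta> y" "\<forall>y>int m. \<eta> y"
    "\<And>x. x \<le> - int m \<or> int m \<le> x \<Longrightarrow> cfg_height \<eta> x = nat x"
    "\<And>x. nat x \<le> cfg_height \<eta> x" by (rule configs_A_D[OF assms]) blast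
  show ?thesis
  proof (rule configs_A_I)
    show "\<forall>y\<le>min (- int m) (k - 1). \<not> swap_sites k \<eta> y" using m by (auto simp: swap_sites_apply)
    show "\<forall>x\<ge>max (int m) (k + 1). cfg_height (swap_sites k \<eta>) x = nat x"
      using m(3) by (auto simp: cfg_height_swap_sites)
  qed
qed

lemma swap_sites_configs_A_iff [simp]: "swap_sites k \<eta> \<in> configs_A \<longleftrightarrow> \<eta> \<in> configs_A"
  using swap_sites_in_configs_A swap_swap by metis

lemma configs_A_bounded_below:
  assumes "\<eta> \<in> configs_A" obtains m where "\<forall>y\<le>m. \<not> \<eta> y"
  using configs_A_D[OF assms] by metis

lemma cfg_height_step_A:
  assumes "\<eta> \<in> configs_A"
  shows "cfg_height \<eta> x = cfg_height \<eta> (x - 1) + of_bool (\<eta> x)"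
  using configs_A_bounded_below[OF assms] cfg_height_step by metis

lemma cfg_height_ge_A: "\<eta> \<in> configs_A \<Longrightarrow> nat x \<le> cfg_height \<eta> x"
  using configs_A_D by metis

lemma cfg_height_mono_A: "\<eta> \<in> configs_A \<Longrightarrow> x \<le> y \<Longrightarrow> cfg_height \<eta> x \<le> cfg_height \<eta> y"
  using configs_A_bounded_below cfg_height_mono by metis

lemma finite_cfg_height_support:
  assumes "\<eta> \<in> configs_A"
  shows "finite {x. cfg_height \<eta> x \<noteq> nat x}"
proof -
  obtain m :: nat where m: "\<And>x. x \<le> - int m \<or> int m \<le> x \<Longrightarrow> cfg_height \<eta> x = nat x"
    using configs_A_D[OF assms] by metis
  have "{x. cfg_height \<eta> x \<noteq> nat x} \<subseteq> {- int m..int m}"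
  proof
    fix x assume "x \<in> {x. cfg_height \<eta> x \<noteq> nat x}"
    then have "\<not> (x \<le> - int m \<or> int m \<le> x)" using m[of x] by auto
    then show "x \<in> {- int m..int m}" by simp
  qed
  then show ?thesis by (rule finite_subset) simp
qed

section \<open>Particles, partitions and Young diagrams in terms of heights\<close>

lemma ex1_particle:
  assumes A: "\<eta> \<in> configs_A" and i: "i \<ge> 1"
  shows "\<exists>!x. \<eta> x \<and> cfg_height \<eta> x = i"
proof -
  obtain m :: nat where m: "\<forall>y\<le>- int m. \<not> \<eta> y" using configs_A_D[OF A] by metis
  let ?P = "\<lambda>n. cfg_height \<eta> (- int m + int n) \<ge> i"
  \<comment> \<open>The height at site \<open>i\<close> is at least \<open>i\<close>, so the climb
    from 0 in unit steps reaches \<open>i\<close>; the site where it first does so carries particle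
    \<open>i\<close>.\<close>
  have "?P (m + i)" using cfg_height_ge_A[OF A, of "int i"] by simp
  then have P: "?P (LEAST n. ?P n)" by (rule LeastI)
  have P0: "\<not> ?P 0" using cfg_height_eq_0[OF m] i by simp
  then obtain n where n: "(LEAST n. ?P n) = Suc n" using P by (cases "LEAST n. ?P n") metis+
  then have nP: "\<not> ?P n" using not_less_Least[of n ?P] by simp
  let ?x = "- int m + int (Suc n)"
  have "cfg_height \<eta> ?x = cfg_height \<eta> (- int m + int n) + of_bool (\<eta> ?x)"
    using cfg_height_step_A[OF A, of ?x] by simp
  then have x: "\<eta> ?x \<and> cfg_height \<eta> ?x = i" using P nP n by (cases "\<eta> ?x") auto
  moreover have "y = z" if "\<eta> y \<and> cfg_height \<eta> y = i" "\<eta> z \<and> cfg_height \<eta> z = i" for y z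
    using that cfg_height_step_A[OF A, of y] cfg_height_step_A[OF A, of z]
      cfg_height_mono_A[OF A, of y "z - 1"] cfg_height_mono_A[OF A, of z "y - 1"]
    by (cases y z rule: linorder_cases) auto
  ultimately show ?thesis by blast
qed

lemma particle_le_iff:
  assumes A: "\<eta> \<in> configs_A" and i: "i \<ge> 1"
  shows "particle \<eta> i \<le> y \<longleftrightarrow> i \<le> cfg_height \<eta> y"
proof -
  have p: "\<eta> (particle \<eta> i)" "cfg_height \<eta> (particle \<eta> i) = i"
    using theI'[OF ex1_particle[OF A i]] by (simp_all add: particle_def cfg_height_def)
  show ?thesis
  proof
    assume "particle \<eta> i \<le> y"
    then show "i \<le> cfg_height \<eta> y" using cfg_height_mono_A[OF A] p(2) by metis
  next
    assume *: "i \<le> cfg_height \<eta> y"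
    show "particle \<eta> i \<le> y"
    proof (rule ccontr)
      assume "\<not> ?thesis"
      then have "cfg_height \<eta> y \<le> cfg_height \<eta> (particle \<eta> i - 1)" by (intro cfg_height_mono_A[OF A]) simp
      then show False using * p cfg_height_step_A[OF A, of "particle \<eta> i"] by simp
    qed
  qed
qed

text \<open>Row \<open>i\<close> has length \<open>i\<close> minus the position of particle
  \<open>i\<close>, so a box is present iff that particle sits at or left of the diagonal index
  \<open>i - j\<close>. All statements about diagrams pass to heights through this.\<close>

lemma le_partition_of_iff:
  assumes A: "\<eta> \<in> configs_A" and "i \<ge> 1" "j \<ge> 1"
  shows "j \<le> partition_of \<eta> i \<longleftrightarrow> i \<le> cfg_height \<eta> (int i - int j)"
proof -
  have "j \<le> partition_of \<eta> i \<longleftrightarrow> particle \<eta> i \<le> int i - int j"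
    using assms by (auto simp: partition_of_def)
  then show ?thesis using particle_le_iff[OF A] assms by simp
qed

lemma young_partition_of:
  assumes "\<eta> \<in> configs_A"
  shows "young (partition_of \<eta>) = {(i, j). 1 \<le> i \<and> 1 \<le> j \<and> i \<le> cfg_height \<eta> (int i - int j)}"
  using le_partition_of_iff[OF assms] by (auto simp: young_def)

lemma partition_of_le_iff:
  assumes A: "\<eta> \<in> configs_A" "\<mu> \<in> configs_A"
  shows "(\<forall>i. partition_of \<mu> i \<le> partition_of \<eta> i) \<longleftrightarrow> (\<forall>x. cfg_height \<mu> x \<le> cfg_height \<eta> x)"
proof
  assume le: "\<forall>i. partition_of \<mu> i \<le> partition_of \<eta> i"
  show "\<forall>x. cfg_height \<mu> x \<le> cfg_height \<eta> x"
  proof (rule allI, rule ccontr)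
    fix x assume "\<not> cfg_height \<mu> x \<le> cfg_height \<eta> x"
    \<comment> \<open>If the height of \<open>\<mu>\<close> is larger at \<open>x\<close>, the last
      box of \<open>\<mu>\<close> on diagonal \<open>x\<close> is missing from
      \<open>\<eta>\<close>.\<close>
    define i where "i = cfg_height \<mu> x"
    define j where "j = nat (int i - x)"
    have lt: "cfg_height \<eta> x < i" using \<open>\<not> _\<close> by (simp add: i_def)
    then have *: "i \<ge> 1" "j \<ge> 1" "int i - int j = x"
      using cfg_height_ge_A[OF A(1), of x] by (auto simp: j_def)
    have "j \<le> partition_of \<mu> i" using le_partition_of_iff[OF A(2) *(1,2)] *(3) by (simp add: i_def)
    then have "j \<le> partition_of \<eta> i" using le order_trans by blast
    then show False using le_partition_of_iff[OF A(1) *(1,2)] *(3) lt by simp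
  qed
next
  assume le: "\<forall>x. cfg_height \<mu> x \<le> cfg_height \<eta> x"
  show "\<forall>i. partition_of \<mu> i \<le> partition_of \<eta> i"
  proof
    fix i
    show "partition_of \<mu> i \<le> partition_of \<eta> i"
    proof (cases "i \<ge> 1 \<and> partition_of \<mu> i \<ge> 1")
      case True
      then show ?thesis
        using le_partition_of_iff[OF A(2), of i "partition_of \<mu> i"]
          le_partition_of_iff[OF A(1), of i "partition_of \<mu> i"] le order_trans by blast
    qed (auto simp: partition_of_def)
  qed
qed

lemma config_eq_if_cfg_height_eq:
  assumes A: "\<eta> \<in> configs_A" "\<mu> \<in> configs_A" and "\<And>x. cfg_height \<eta> x = cfg_height \<mu> x"
  shows "\<eta> = \<mu>"
proof
  fix x show "\<eta> x = \<mu> x"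
    using assms(3)[of x] assms(3)[of "x - 1"] cfg_height_step_A[OF A(1), of x]
      cfg_height_step_A[OF A(2), of x] by (cases "\<eta> x"; cases "\<mu> x") auto
qed

lemma partition_of_eq_iff:
  assumes A: "\<eta> \<in> configs_A" "\<mu> \<in> configs_A"
  shows "partition_of \<eta> = partition_of \<mu> \<longleftrightarrow> \<eta> = \<mu>"
proof
  assume eq: "partition_of \<eta> = partition_of \<mu>"
  have "cfg_height \<eta> x = cfg_height \<mu> x" for x
    using partition_of_le_iff[OF A] partition_of_le_iff[OF A(2,1)] eq by (simp add: order_antisym)
  then show "\<eta> = \<mu>" by (rule config_eq_if_cfg_height_eq[OF A])
qed simp

text \<open>The prescribed positions \<open>X i\<close> increase strictly because the parts do not
  increase, and \<open>X i = i\<close> eventually; this gives surjectivity of the identification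
  with partitions.\<close>

lemma ex_config_of_partition:
  assumes "is_partition \<mu>"
  obtains \<eta> where "\<eta> \<in> configs_A" "partition_of \<eta> = \<mu>"
proof -
  have mu0: "\<mu> 0 = 0" and dec: "\<And>i. i \<ge> 1 \<Longrightarrow> \<mu> (Suc i) \<le> \<mu> i" and fin: "finite {i. \<mu> i \<noteq> 0}"
    using assms by (auto simp: is_partition_def)
  obtain M where M: "\<And>i. i > M \<Longrightarrow> \<mu> i = 0"
    using fin finite_nat_set_iff_bounded_le by (metis (mono_tags, lifting) mem_Collect_eq not_le)
  define X where "X i = int i - int (\<mu> i)" for i
  define \<eta> where "\<eta> x \<longleftrightarrow> (\<exists>i\<ge>1. x = X i)" for x
  have less: "X i < X j" if "1 \<le> i" "i < j" for i j
    using that(2,1)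
  proof (induction j rule: less_Suc_induct)
    case (1 i)
    then show ?case using dec[of i] by (simp add: X_def)
  qed auto
  have le_iff: "X i \<le> X j \<longleftrightarrow> i \<le> j" if "1 \<le> i" "1 \<le> j" for i j
    using less[of i j] less[of j i] that by (cases i j rule: linorder_cases) auto
  have inj: "inj_on X {1..}"
  proof (rule inj_onI)
    fix i j assume "i \<in> {1..}" "j \<in> {1..}" "X i = X j"
    then show "i = j" using le_iff[of i j] le_iff[of j i] by simp
  qed
  have h: "cfg_height \<eta> x = card {i. i \<ge> 1 \<and> X i \<le> x}" for x
  proof -
    have "{y. y \<le> x \<and> \<eta> y} = X ` {i. i \<ge> 1 \<and> X i \<le> x}" by (auto simp: \<eta>_def)
    then show ?thesis
      unfolding cfg_height_def by (simp, intro card_image inj_on_subset[OF inj]) auto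
  qed
  have hX: "cfg_height \<eta> (X i) = i" if "i \<ge> 1" for i
  proof -
    have "{j. j \<ge> 1 \<and> X j \<le> X i} = {1..i}" using le_iff that by auto
    then show ?thesis by (simp add: h)
  qed
  have A: "\<eta> \<in> configs_A"
  proof (rule configs_A_I)
    show "\<forall>y\<le>X 1 - 1. \<not> \<eta> y"
      using le_iff[of 1] by (force simp: \<eta>_def)
    show "\<forall>x\<ge>int M. cfg_height \<eta> x = nat x"
    proof (intro allI impI)
      fix x assume x: "x \<ge> int M"
      have "X i \<le> x \<longleftrightarrow> i \<le> nat x" if "i \<ge> 1" for i
      proof (cases "i \<le> nat x")
        case True
        then show ?thesis using x by (simp add: X_def)
      next
        case False
        then show ?thesis using M[of i] x by (simp add: X_def)
      qed
      then have "{i. i \<ge> 1 \<and> X i \<le> x} = {1..nat x}" by auto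
      then show "cfg_height \<eta> x = nat x" by (simp add: h)
    qed
  qed
  moreover have "partition_of \<eta> i = \<mu> i" for i
  proof (cases "i \<ge> 1")
    case True
    have "\<eta> (X i)" using True by (auto simp: \<eta>_def)
    then have "particle \<eta> i = X i"
      using ex1_particle[OF A True] hX[OF True]
      unfolding particle_def cfg_height_def[symmetric] by (intro the1_equality) auto
    then show ?thesis using True by (simp add: partition_of_def X_def)
  next
    case False
    then have "i = 0" by simp
    then show ?thesis using mu0 by (simp add: partition_of_def)
  qed
  ultimately show ?thesis using that by blast
qed

section \<open>A local product formula for the weights\<close>

text \<open>There is one box per diagonal and neighbouring diagonals in \<open>S\<close> carry
  adjacent boxes, so components are the maximal runs of \<open>S\<close>. Each run is counted by its
  left end.\<close>

lemma card_components_diagonal_boxes: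
  fixes box :: "int \<Rightarrow> nat \<times> nat"
  assumes "finite S"
    and content: "\<And>x. x \<in> S \<Longrightarrow> int (fst (box x)) - int (snd (box x)) = x"
    and adj: "\<And>x. x \<in> S \<Longrightarrow> x + 1 \<in> S \<Longrightarrow> adjacent (box x) (box (x + 1))"
  shows "card (components (box ` S)) = card {x \<in> S. x - 1 \<notin> S}"
proof -
  define R where "R = {(p, p'). p \<in> box ` S \<and> p' \<in> box ` S \<and> adjacent p p'}"
  let ?f = "\<lambda>x. R\<^sup>* `` {box x}"
  let ?L = "{x \<in> S. x - 1 \<notin> S}"
  have "sym R" by (auto simp: R_def sym_def adjacent_def)
  then have symR: "sym (R\<^sup>*)" by (rule sym_rtrancl)
  have cls: "?f x = ?f y" if "(box x, box y) \<in> R\<^sup>*" for x y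
    using that symD[OF symR that] by (auto intro: rtrancl_trans)
  have "inj_on box S" by (metis content inj_onI)
  have dist1: "y = x + 1 \<or> x = y + 1" if "x \<in> S" "y \<in> S" "adjacent (box x) (box y)" for x y
    using that content[of x] content[of y] by (auto simp: adjacent_def)
  \<comment> \<open>A path moves by one diagonal at a time, so when it starts at a left end
    \<open>x\<close> it cannot cross the missing diagonal \<open>x - 1\<close>.\<close>
  have right: "\<exists>y\<in>S. p = box y \<and> x \<le> y" if "x \<in> ?L" "(box x, p) \<in> R\<^sup>*" for x p
    using that(2)
  proof (induction rule: rtrancl_induct)
    case base
    then show ?case using that(1) by auto
  next
    case (step p p')
    then obtain y z where yz: "y \<in> S" "p = box y" "x \<le> y" "z \<in> S" "p' = box z" "adjacent p p'"
      unfolding R_def by blast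
    then have "y = z + 1 \<or> z = y + 1" using dist1 by blast
    then have "x \<le> z" using yz that(1) by (cases "y = x") auto
    then show ?case using yz by blast
  qed
  have "inj_on ?f ?L"
  proof (rule inj_onI)
    fix x y assume xy: "x \<in> ?L" "y \<in> ?L" "?f x = ?f y"
    have "x \<le> y" if xy: "x \<in> ?L" "y \<in> ?L" "?f x = ?f y" for x y
    proof -
      have "(box x, box y) \<in> R\<^sup>*" using xy(3) by blast
      then obtain z where "z \<in> S" "box y = box z" "x \<le> z" using right[OF xy(1)] by blast
      then show ?thesis using \<open>inj_on box S\<close> xy(2) by (metis (no_types, lifting) inj_onD mem_Collect_eq)
    qed
    from this[OF xy] this[OF xy(2,1) xy(3)[symmetric]] show "x = y" by simp
  qed
  moreover have "?f ` S = ?f ` ?L"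
  proof (intro equalityI subsetI)
    fix c assume "c \<in> ?f ` S"
    then obtain y where y: "y \<in> S" "c = ?f y" by blast
    \<comment> \<open>Every run is bounded to the left since \<open>S\<close> is finite; the first
      missing diagonal left of \<open>y\<close> locates the left end of its run.\<close>
    have "\<exists>n. y - int n \<notin> S"
    proof (rule ccontr)
      assume "\<not> ?thesis"
      then have "range (\<lambda>n. y - int n) \<subseteq> S" by auto
      then have "finite (range (\<lambda>n. y - int n))" using \<open>finite S\<close> by (rule finite_subset)
      moreover have "inj (\<lambda>n. y - int n)" by (auto intro: injI)
      ultimately show False using finite_imageD by blast
    qed
    then obtain n where n: "y - int n \<notin> S" "\<And>m. m < n \<Longrightarrow> y - int m \<in> S"
      using exists_least_iff[of "\<lambda>n. y - int n \<notin> S"] by blast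
    have chain: "(box (y - int m), box y) \<in> R\<^sup>*" if "m < n" for m
      using that
    proof (induction m)
      case (Suc m)
      have "adjacent (box (y - int (Suc m))) (box (y - int m))"
        using adj[of "y - int (Suc m)"] n(2)[of m] n(2)[of "Suc m"] Suc.prems by simp
      then have "(box (y - int (Suc m)), box (y - int m)) \<in> R"
        using n(2)[of m] n(2)[of "Suc m"] Suc.prems by (auto simp: R_def)
      then show ?case using Suc by (meson Suc_lessD converse_rtrancl_into_rtrancl)
    qed simp
    have "n \<noteq> 0" using n(1) y(1) by (cases n) auto
    then obtain m where m: "n = Suc m" by (cases n) auto
    have "y - int m \<in> ?L" using n m by (auto simp: algebra_simps)
    moreover have "c = ?f (y - int m)" using cls[OF chain[of m]] m y(2) by simp
    ultimately show "c \<in> ?f ` ?L" by blast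
  qed auto
  moreover have "components (box ` S) = ?f ` S"
    unfolding components_def R_def[symmetric] quotient_def by auto
  ultimately show ?thesis by (simp add: card_image)
qed

section \<open>The gap between two height functions\<close>

definition gap :: "config \<Rightarrow> config \<Rightarrow> int \<Rightarrow> int" where
  "gap \<eta> \<mu> x = int (cfg_height \<eta> x) - int (cfg_height \<mu> x)"

lemma gap_step:
  assumes "\<eta> \<in> configs_A" "\<mu> \<in> configs_A"
  shows "gap \<eta> \<mu> x = gap \<eta> \<mu> (x - 1) + of_bool (\<eta> x) - of_bool (\<mu> x)"
  using cfg_height_step_A[OF assms(1), of x] cfg_height_step_A[OF assms(2), of x] by (simp add: gap_def)

lemma finite_gap_support:
  assumes "\<eta> \<in> configs_A" "\<mu> \<in> configs_A"
  shows "finite {x. gap \<eta> \<mu> x \<noteq> 0}"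
  by (rule finite_subset[of _ "{x. cfg_height \<eta> x \<noteq> nat x} \<union> {x. cfg_height \<mu> x \<noteq> nat x}"])
    (use assms in \<open>auto simp: gap_def finite_cfg_height_support\<close>)

text \<open>A site occupied in \<open>\<eta>\<close> only changes the gap, which is therefore
  nonzero at that site or just before it.\<close>

lemma finite_increases:
  assumes "\<eta> \<in> configs_A" "\<mu> \<in> configs_A"
  shows "finite {x. \<eta> x \<and> \<not> \<mu> x}"
proof (rule finite_subset)
  show "{x. \<eta> x \<and> \<not> \<mu> x} \<subseteq> {x. gap \<eta> \<mu> x \<noteq> 0} \<union> (\<lambda>x. x + 1) ` {x. gap \<eta> \<mu> x \<noteq> 0}"
  proof
    fix x assume "x \<in> {x. \<eta> x \<and> \<not> \<mu> x}"
    then have "gap \<eta> \<mu> x \<noteq> 0 \<or> gap \<eta> \<mu> (x - 1) \<noteq> 0" using gap_step[OF assms, of x] by auto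
    then show "x \<in> {x. gap \<eta> \<mu> x \<noteq> 0} \<union> (\<lambda>x. x + 1) ` {x. gap \<eta> \<mu> x \<noteq> 0}"
      by (metis (mono_tags, lifting) UnI1 UnI2 diff_add_cancel image_eqI mem_Collect_eq)
  qed
qed (use finite_gap_support[OF assms] in auto)

text \<open>The box \<open>(i + 1, j + 1)\<close> lies on the same diagonal as
  \<open>(i, j)\<close>, so removing a rim deletes exactly the last box of each nonempty
  diagonal.\<close>

lemma peel_partition_of:
  assumes "\<eta> \<in> configs_A"
  shows "peel (partition_of \<eta>) k =
    {(i, j). 1 \<le> i \<and> 1 \<le> j \<and> i + k \<le> cfg_height \<eta> (int i - int j)}"
proof (induction k)
  case 0
  then show ?case by (simp add: peel_def young_partition_of[OF assms])
next
  case (Suc k)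
  have "peel (partition_of \<eta>) (Suc k) = peel (partition_of \<eta>) k - rim (peel (partition_of \<eta>) k)"
    by (simp add: peel_def)
  moreover have "int (i + 1) - int (j + 1) = int i - int j" for i j by simp
  then have "(i, j) \<in> D - rim D \<longleftrightarrow> 1 \<le> i \<and> 1 \<le> j \<and> i + Suc k \<le> cfg_height \<eta> (int i - int j)"
    if "D = {(i, j). 1 \<le> i \<and> 1 \<le> j \<and> i + k \<le> cfg_height \<eta> (int i - int j)}" for i j D
    unfolding that rim_def by (simp only: mem_Collect_eq case_prod_conv Diff_iff) arith
  then have "peel (partition_of \<eta>) k - rim (peel (partition_of \<eta>) k) =
    {(i, j). 1 \<le> i \<and> 1 \<le> j \<and> i + Suc k \<le> cfg_height \<eta> (int i - int j)}"
    using Suc by blast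
  ultimately show ?case by simp
qed

text \<open>On each diagonal the \<open>k\<close>-th rim has at most one box, and a box of it lies
  outside \<open>\<mu>\<close> iff the gap there is at least \<open>k\<close>. Runs of such
  diagonals begin where the gap steps up to exactly \<open>k\<close>.\<close>

lemma n_comp_partition_of:
  assumes A: "\<eta> \<in> configs_A" "\<mu> \<in> configs_A" and k: "k \<ge> 1"
  shows "n_comp (partition_of \<eta>) (partition_of \<mu>) k = card {x. \<eta> x \<and> \<not> \<mu> x \<and> gap \<eta> \<mu> x = int k}"
proof -
  \<comment> \<open>The last box on diagonal \<open>x\<close> after \<open>k - 1\<close> rims are
    removed; on \<open>?S\<close> the truncated subtractions are exact by
    \<open>big\<close>.\<close>
  define box where
    "box x = (cfg_height \<eta> x + 1 - k, nat (int (cfg_height \<eta> x + 1 - k) - x))" for x :: int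
  let ?S = "{x. int k \<le> gap \<eta> \<mu> x}"
  have "finite ?S" by (rule finite_subset[OF _ finite_gap_support[OF A]]) (use k in auto)
  have big: "cfg_height \<eta> x + 1 - k > cfg_height \<mu> x" "int (cfg_height \<eta> x + 1 - k) - x \<ge> 1"
    if "x \<in> ?S" for x
    using that cfg_height_ge_A[OF A(2), of x] unfolding gap_def mem_Collect_eq by linarith+
  have content: "int (fst (box x)) - int (snd (box x)) = x" if "x \<in> ?S" for x
    using big[OF that] by (simp add: box_def)
  have "rim (peel (partition_of \<eta>) (k - 1)) - young (partition_of \<mu>) = box ` ?S"
  proof (intro equalityI subsetI)
    fix p assume "p \<in> rim (peel (partition_of \<eta>) (k - 1)) - young (partition_of \<mu>)"
    then obtain i j where p: "p = (i, j)" "1 \<le> i" "1 \<le> j"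
      "i + (k - 1) = cfg_height \<eta> (int i - int j)" "i > cfg_height \<mu> (int i - int j)"
      unfolding peel_partition_of[OF A(1)] young_partition_of[OF A(2)]
      by (cases p) (auto simp: rim_def)
    then have "p = box (int i - int j)" "int i - int j \<in> ?S"
      using k by (auto simp: box_def gap_def)
    then show "p \<in> box ` ?S" by blast
  next
    fix p assume "p \<in> box ` ?S"
    then obtain x where x: "x \<in> ?S" "p = box x" by blast
    define i where "i = cfg_height \<eta> x + 1 - k"
    define j where "j = nat (int i - x)"
    have "p = (i, j)" using x by (simp add: box_def i_def j_def)
    moreover have "int i - int j = x" "i > cfg_height \<mu> x" "j \<ge> 1" "i + (k - 1) = cfg_height \<eta> x"
      using big[OF x(1)] k by (auto simp: i_def j_def)
    ultimately show "p \<in> rim (peel (partition_of \<eta>) (k - 1)) - young (partition_of \<mu>)"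
      unfolding peel_partition_of[OF A(1)] young_partition_of[OF A(2)] by (auto simp: rim_def)
  qed
  moreover have "card (components (box ` ?S)) = card {x \<in> ?S. x - 1 \<notin> ?S}"
  proof (rule card_components_diagonal_boxes[OF \<open>finite ?S\<close> content])
    fix x assume x: "x \<in> ?S" "x + 1 \<in> ?S"
    \<comment> \<open>From one diagonal to the next the height grows by 0 or 1, so the rim either
      lowers its column by one or raises its row by one.\<close>
    have "cfg_height \<eta> (x + 1) = cfg_height \<eta> x \<or> cfg_height \<eta> (x + 1) = cfg_height \<eta> x + 1"
      using cfg_height_step_A[OF A(1), of "x + 1"] by (cases "\<eta> (x + 1)") auto
    then have "fst (box (x + 1)) = fst (box x) \<or> fst (box (x + 1)) = fst (box x) + 1"
      using big(1)[OF x(1)] big(1)[OF x(2)] unfolding box_def fst_conv by arith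
    then show "adjacent (box x) (box (x + 1))"
      using content[OF x(1)] content[OF x(2)] unfolding adjacent_def by arith
  qed
  moreover have "{x \<in> ?S. x - 1 \<notin> ?S} = {x. \<eta> x \<and> \<not> \<mu> x \<and> gap \<eta> \<mu> x = int k}"
  proof -
    have "x \<in> ?S \<and> x - 1 \<notin> ?S \<longleftrightarrow> \<eta> x \<and> \<not> \<mu> x \<and> gap \<eta> \<mu> x = int k" for x
      using gap_step[OF A, of x] by (cases "\<eta> x"; cases "\<mu> x") auto
    then show ?thesis by blast
  qed
  ultimately show ?thesis by (simp add: n_comp_def)
qed

text \<open>The boxes are counted by diagonals instead of rows: diagonal \<open>x\<close> meets rows
  \<open>nat x + 1\<close> up to the height at \<open>x\<close>.\<close>

lemma partition_size_partition_of:
  assumes A: "\<mu> \<in> configs_A"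
  shows "partition_size (partition_of \<mu>) =
    (\<Sum>x | cfg_height \<mu> x \<noteq> nat x. cfg_height \<mu> x - nat x)"
proof -
  let ?l = "partition_of \<mu>" and ?I = "{x. cfg_height \<mu> x \<noteq> nat x}"
  let ?D = "SIGMA x:?I. {nat x<..cfg_height \<mu> x}"
  have diag: "bij_betw (\<lambda>(x, i). (i, nat (int i - x))) ?D (young ?l)"
  proof (rule bij_betwI[where g = "\<lambda>(i, j). (int i - int j, i)"])
    show "(\<lambda>(x, i). (i, nat (int i - x))) \<in> ?D \<rightarrow> young ?l"
    proof
      fix p assume "p \<in> ?D"
      then obtain x i where p: "p = (x, i)" "nat x < i" "i \<le> cfg_height \<mu> x" by auto
      moreover have "int i - int (nat (int i - x)) = x" "1 \<le> nat (int i - x)" "1 \<le> i"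
        using p(2) by linarith+
      ultimately show "(case p of (x, i) \<Rightarrow> (i, nat (int i - x))) \<in> young ?l"
        unfolding young_partition_of[OF A] by simp
    qed
    show "(\<lambda>(i, j). (int i - int j, i)) \<in> young ?l \<rightarrow> ?D"
    proof
      fix p assume "p \<in> young ?l"
      then obtain i j where p: "p = (i, j)" "1 \<le> i" "1 \<le> j" "i \<le> cfg_height \<mu> (int i - int j)"
        unfolding young_partition_of[OF A] by blast
      have "nat (int i - int j) < i" using p(2,3) by linarith
      then show "(case p of (i, j) \<Rightarrow> (int i - int j, i)) \<in> ?D" using p(1,4) by simp
    qed
  next
    fix p assume "p \<in> ?D"
    then obtain x i where p: "p = (x, i)" "nat x < i" by auto
    then have "int i - int (nat (int i - x)) = x" by linarith
    then show "(case case p of (x, i) \<Rightarrow> (i, nat (int i - x)) of (i, j) \<Rightarrow> (int i - int j, i)) = p"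
      using p(1) by simp
  qed (simp split: prod.split)
  have fin: "finite (SIGMA x:?I. {nat x<..cfg_height \<mu> x})"
    using finite_cfg_height_support[OF A] by auto
  have "finite (young ?l)" using bij_betw_finite[OF diag] fin by simp
  moreover have "{i. ?l i \<noteq> 0} \<subseteq> fst ` young ?l"
  proof
    fix i assume "i \<in> {i. ?l i \<noteq> 0}"
    then have "(i, ?l i) \<in> young ?l" by (cases "i = 0") (auto simp: young_def partition_of_def)
    then show "i \<in> fst ` young ?l" by (metis fst_conv image_eqI)
  qed
  ultimately have finI: "finite {i. ?l i \<noteq> 0}" by (metis finite_imageI finite_subset)
  have "young ?l = (SIGMA i:{i. ?l i \<noteq> 0}. {1..?l i})"
  proof -
    have "?l 0 = 0" by (simp add: partition_of_def)
    then have "i \<ge> 1 \<and> j \<ge> 1 \<and> j \<le> ?l i \<longleftrightarrow> ?l i \<noteq> 0 \<and> 1 \<le> j \<and> j \<le> ?l i" for i j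
      by (cases i) auto
    then show ?thesis
      by (intro set_eqI, simp only: young_def split_paired_all mem_Collect_eq case_prod_conv
          mem_Sigma_iff atLeastAtMost_iff)
  qed
  then have "partition_size ?l = card (young ?l)"
    using finI by (simp add: partition_size_def)
  also have "\<dots> = card (SIGMA x:?I. {nat x<..cfg_height \<mu> x})"
    using bij_betw_same_card[OF diag] by simp
  also have "\<dots> = (\<Sum>x\<in>?I. cfg_height \<mu> x - nat x)"
    using finite_cfg_height_support[OF A] by simp
  finally show ?thesis .
qed

text \<open>The gap may be negative, hence \<open>powi\<close>; if it is, it returns to \<open>0\<close> further right through an
  up-step, whose factor is \<open>1 - q\<^sup>0 = 0\<close>.\<close>

definition local_weight :: "real \<Rightarrow> config \<Rightarrow> config \<Rightarrow> real" where
  "local_weight q \<eta> \<mu> =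
     q ^ (\<Sum>x | cfg_height \<mu> x \<noteq> nat x. cfg_height \<mu> x - nat x) *
     (\<Prod>x | \<eta> x \<and> \<not> \<mu> x. 1 - q powi gap \<eta> \<mu> x)"

lemma local_weight_eq_0:
  assumes A: "\<eta> \<in> configs_A" "\<mu> \<in> configs_A" and neg: "gap \<eta> \<mu> x < 0"
  shows "local_weight q \<eta> \<mu> = 0"
proof -
  obtain m :: nat where m: "\<And>x. x \<le> - int m \<or> int m \<le> x \<Longrightarrow> cfg_height \<eta> x = nat x"
    using configs_A_D[OF A(1)] by metis
  obtain m' :: nat where m': "\<And>x. x \<le> - int m' \<or> int m' \<le> x \<Longrightarrow> cfg_height \<mu> x = nat x"
    using configs_A_D[OF A(2)] by metis
  let ?P = "\<lambda>n. gap \<eta> \<mu> (x + int n) \<ge> 0"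
  have "gap \<eta> \<mu> y = 0" if "int m \<le> y" "int m' \<le> y" for y
    using m m' that by (simp add: gap_def)
  then have "?P (nat \<bar>x\<bar> + m + m')" by simp
  \<comment> \<open>At the first site right of \<open>x\<close> where the gap is nonnegative again,
    a unit step leads from -1 to 0, which gives the vanishing factor.\<close>
  then obtain n where n: "?P n" "\<And>i. i < n \<Longrightarrow> \<not> ?P i"
    using exists_least_iff[of ?P] by blast
  have "n \<noteq> 0" using n(1) neg by (cases n) auto
  then obtain i where i: "n = Suc i" by (cases n) auto
  let ?y = "x + int n"
  have "gap \<eta> \<mu> (?y - 1) < 0" using n(2)[of i] i by (simp add: algebra_simps)
  then have y: "\<eta> ?y" "\<not> \<mu> ?y" "gap \<eta> \<mu> ?y = 0"
    using gap_step[OF A, of ?y] n(1) by (cases "\<eta> ?y"; cases "\<mu> ?y"; auto)+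
  then have "(\<Prod>x | \<eta> x \<and> \<not> \<mu> x. 1 - q powi gap \<eta> \<mu> x) = 0"
    using finite_increases[OF A] by (intro prod_zero bexI[of _ ?y]) simp_all
  then show ?thesis by (simp add: local_weight_def)
qed

text \<open>Grouping the sites occupied in \<open>\<eta>\<close> only by the value \<open>k\<close>
  of the gap yields \<open>n_comp\<close> equal factors \<open>1 - q ^ k\<close>. If the gap is
  negative somewhere, both sides vanish.\<close>

lemma v_config_eq_local_weight:
  assumes A: "\<eta> \<in> configs_A" "\<mu> \<in> configs_A"
  shows "v_config q \<eta> (partition_of \<mu>) = local_weight q \<eta> \<mu>"
proof (cases "\<forall>x. gap \<eta> \<mu> x \<ge> 0")
  case False
  then obtain x where x: "gap \<eta> \<mu> x < 0" by (auto simp: not_le)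
  then have "\<not> cfg_height \<mu> x \<le> cfg_height \<eta> x" by (simp add: gap_def)
  then have "\<not> (\<forall>i. partition_of \<mu> i \<le> partition_of \<eta> i)"
    using partition_of_le_iff[OF A] by blast
  then have "v_weight q (partition_of \<eta>) (partition_of \<mu>) = 0"
    unfolding v_weight_def by (rule if_not_P)
  then show ?thesis
    using A local_weight_eq_0[OF A x] by (simp add: v_config_def)
next
  case True
  let ?I = "{x. \<eta> x \<and> \<not> \<mu> x}" and ?n = "n_comp (partition_of \<eta>) (partition_of \<mu>)"
  let ?g = "\<lambda>x. nat (gap \<eta> \<mu> x)"
  \<comment> \<open>The gap just before an up-step is nonnegative, so afterwards it is at least 1
    and the index \<open>k = 0\<close> never occurs.\<close>
  have pos: "gap \<eta> \<mu> x \<ge> 1" if "x \<in> ?I" for x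
    using True[rule_format, of "x - 1"] gap_step[OF A, of x] that by auto
  have n: "?n k = card {x \<in> ?I. ?g x = k}" if "k \<ge> 1" for k
  proof -
    have "{x. \<eta> x \<and> \<not> \<mu> x \<and> gap \<eta> \<mu> x = int k} = {x \<in> ?I. ?g x = k}" using that by auto
    then show ?thesis using n_comp_partition_of[OF A that] by simp
  qed
  have fin: "finite ?I" by (rule finite_increases[OF A])
  have T: "{k. k \<ge> 1 \<and> ?n k \<noteq> 0} = ?g ` ?I"
  proof (intro equalityI subsetI)
    fix k assume "k \<in> {k. k \<ge> 1 \<and> ?n k \<noteq> 0}"
    then have "k \<ge> 1" "?n k \<noteq> 0" by blast+
    then have "card {x \<in> ?I. ?g x = k} \<noteq> 0" using n by metis
    then have "{x \<in> ?I. ?g x = k} \<noteq> {}" by (metis card.empty)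
    then show "k \<in> ?g ` ?I" by blast
  next
    fix k assume "k \<in> ?g ` ?I"
    then obtain x where x: "x \<in> ?I" "k = ?g x" by blast
    have k: "k \<ge> 1" using pos[OF x(1)] x(2) by linarith
    have "x \<in> {x \<in> ?I. ?g x = k}" using x by blast
    then have "{x \<in> ?I. ?g x = k} \<noteq> {}" by (metis emptyE)
    moreover have "finite {x \<in> ?I. ?g x = k}"
      by (rule finite_subset[OF Collect_restrict fin])
    ultimately have "card {x \<in> ?I. ?g x = k} \<noteq> 0" by (metis card_0_eq)
    then show "k \<in> {k. k \<ge> 1 \<and> ?n k \<noteq> 0}" using k n[OF k] by simp
  qed
  have "(\<Prod>k | k \<ge> 1 \<and> ?n k \<noteq> 0. (1 - q ^ k) ^ ?n k)
      = (\<Prod>k\<in>?g ` ?I. \<Prod>x\<in>{x \<in> ?I. ?g x = k}. 1 - q powi gap \<eta> \<mu> x)"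
    unfolding T
  proof (rule prod.cong)
    fix k assume "k \<in> ?g ` ?I"
    then obtain y where y: "y \<in> ?I" "k = ?g y" by blast
    have k: "k \<ge> 1" using pos[OF y(1)] y(2) by linarith
    have "q powi gap \<eta> \<mu> x = q ^ k" if "x \<in> {x \<in> ?I. ?g x = k}" for x
      using that pos[of x] unfolding power_int_def by simp
    then have "(\<Prod>x\<in>{x \<in> ?I. ?g x = k}. 1 - q powi gap \<eta> \<mu> x) = (\<Prod>x\<in>{x \<in> ?I. ?g x = k}. 1 - q ^ k)"
      by (intro prod.cong) auto
    then show "(1 - q ^ k) ^ ?n k = (\<Prod>x\<in>{x \<in> ?I. ?g x = k}. 1 - q powi gap \<eta> \<mu> x)"
      using n[OF k] by simp
  qed simp
  also have "\<dots> = (\<Prod>x\<in>?I. 1 - q powi gap \<eta> \<mu> x)"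
    using fin by (intro prod.group) auto
  finally have "(\<Prod>k | k \<ge> 1 \<and> ?n k \<noteq> 0. (1 - q ^ k) ^ ?n k) = (\<Prod>x\<in>?I. 1 - q powi gap \<eta> \<mu> x)" .
  moreover have "\<forall>i. partition_of \<mu> i \<le> partition_of \<eta> i"
    using partition_of_le_iff[OF A] True by (simp add: gap_def)
  ultimately show ?thesis
    using A by (simp add: v_config_def v_weight_def local_weight_def partition_size_partition_of)
qed

text \<open>All factors lie in [0, 1]. The bound supplies integrability and the dominating constant
  for limits of expectations.\<close>

lemma abs_v_config_le_1:
  assumes "0 \<le> q" "q \<le> 1"
  shows "\<bar>v_config q \<eta> \<mu>\<bar> \<le> 1"
proof -
  have "0 \<le> q ^ k \<and> q ^ k \<le> 1" for k using assms by (simp add: power_le_one)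
  then have "0 \<le> (1 - q ^ k) ^ n \<and> (1 - q ^ k) ^ n \<le> 1" for k n
    by (simp add: power_le_one)
  then have "0 \<le> (\<Prod>k\<in>K. (1 - q ^ k) ^ f k) \<and> (\<Prod>k\<in>K. (1 - q ^ k) ^ f k) \<le> 1" for K and f :: "nat \<Rightarrow> nat"
    by (simp add: prod_nonneg prod_le_1)
  moreover have "0 \<le> q ^ n \<and> q ^ n \<le> 1" for n using assms by (simp add: power_le_one)
  ultimately show ?thesis
    by (auto simp: v_config_def v_weight_def abs_mult intro!: mult_le_one)
qed

section \<open>Duality at a single vertex\<close>

text \<open>The mean of \<open>F\<close> after an uncensored vertex has acted, with \<open>a\<close>
  and \<open>b\<close> the probabilities of going straight from below and from the left. Site
  \<open>k\<close> holds the edge from the left and site \<open>k + 1\<close> the one from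
  below.\<close>

definition vertex_op :: "real \<Rightarrow> real \<Rightarrow> int \<Rightarrow> (config \<Rightarrow> real) \<Rightarrow> config \<Rightarrow> real" where
  "vertex_op a b k F \<eta> =
     (if \<eta> k = \<eta> (k + 1) then F \<eta>
      else if \<eta> k then b * F (swap_sites k \<eta>) + (1 - b) * F \<eta>
      else a * F (swap_sites k \<eta>) + (1 - a) * F \<eta>)"

text \<open>Moving the particle from \<open>k + 1\<close> to \<open>k\<close> raises the height at
  \<open>k\<close> by one and changes it nowhere else, which adds a single box on that
  diagonal.\<close>

lemma size_swap_sites:
  assumes A: "\<mu> \<in> configs_A" and k: "\<not> \<mu> k" "\<mu> (k + 1)"
  shows "(\<Sum>x | cfg_height (swap_sites k \<mu>) x \<noteq> nat x. cfg_height (swap_sites k \<mu>) x - nat x) =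
    Suc (\<Sum>x | cfg_height \<mu> x \<noteq> nat x. cfg_height \<mu> x - nat x)"
proof -
  let ?m = "swap_sites k \<mu>"
  let ?S = "insert k ({x. cfg_height ?m x \<noteq> nat x} \<union> {x. cfg_height \<mu> x \<noteq> nat x})"
  have A': "?m \<in> configs_A" using A by simp
  have fin: "finite ?S"
    using finite_cfg_height_support[OF A] finite_cfg_height_support[OF A'] by simp
  have ext: "(\<Sum>x | cfg_height \<zeta> x \<noteq> nat x. cfg_height \<zeta> x - nat x) =
    (cfg_height \<zeta> k - nat k) + (\<Sum>x\<in>?S - {k}. cfg_height \<zeta> x - nat x)"
    if "\<zeta> = ?m \<or> \<zeta> = \<mu>" for \<zeta>
  proof -
    have "(\<Sum>x | cfg_height \<zeta> x \<noteq> nat x. cfg_height \<zeta> x - nat x) = (\<Sum>x\<in>?S. cfg_height \<zeta> x - nat x)"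
      using that by (intro sum.mono_neutral_left fin) auto
    also have "\<dots> = (cfg_height \<zeta> k - nat k) + (\<Sum>x\<in>?S - {k}. cfg_height \<zeta> x - nat x)"
      using fin by (intro sum.remove) auto
    finally show ?thesis .
  qed
  have rest: "(\<Sum>x\<in>?S - {k}. cfg_height ?m x - nat x) = (\<Sum>x\<in>?S - {k}. cfg_height \<mu> x - nat x)"
  proof (rule sum.cong)
    fix x assume "x \<in> ?S - {k}"
    then have "x \<noteq> k" by blast
    from cfg_height_swap_sites[OF this] show "cfg_height ?m x - nat x = cfg_height \<mu> x - nat x"
      by (rule arg_cong)
  qed (rule refl)
  have "?m k" using k by (simp add: swap_sites_apply)
  then have "cfg_height ?m k = Suc (cfg_height ?m (k - 1))" using cfg_height_step_A[OF A', of k] by simp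
  moreover have "cfg_height \<mu> k = cfg_height \<mu> (k - 1)" using cfg_height_step_A[OF A, of k] k by simp
  moreover have "cfg_height ?m (k - 1) = cfg_height \<mu> (k - 1)" by (rule cfg_height_swap_sites) simp
  ultimately have "cfg_height ?m k = Suc (cfg_height \<mu> k)" by (simp only:)
  then have "cfg_height ?m k - nat k = Suc (cfg_height \<mu> k - nat k)"
    using cfg_height_ge_A[OF A, of k] by (simp only: Suc_diff_le)
  then show ?thesis
    unfolding ext[OF disjI1[OF refl]] ext[OF disjI2[OF refl]] rest by (simp only: add_Suc)
qed

text \<open>Separates what swaps at \<open>k\<close> can affect: the power of \<open>q\<close> and
  the factors at the two sites. The product over the other sites and the gap at \<open>k - 1\<close>
  stay the same.\<close>

lemma local_weight_two_sites:
  fixes q :: real and k :: int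
  assumes A: "\<eta> \<in> configs_A" "\<mu> \<in> configs_A"
  defines "f \<equiv> \<lambda>a b g. if a \<and> \<not> b then 1 - q powi g else 1"
    and "g \<equiv> gap \<eta> \<mu> (k - 1)"
  shows "local_weight q \<eta> \<mu> =
     q ^ (\<Sum>x | cfg_height \<mu> x \<noteq> nat x. cfg_height \<mu> x - nat x) *
     (\<Prod>x\<in>{x. \<eta> x \<and> \<not> \<mu> x} - {k, k + 1}. 1 - q powi gap \<eta> \<mu> x) *
     f (\<eta> k) (\<mu> k) (g + of_bool (\<eta> k) - of_bool (\<mu> k)) *
     f (\<eta> (k + 1)) (\<mu> (k + 1))
       (g + of_bool (\<eta> k) - of_bool (\<mu> k) + of_bool (\<eta> (k + 1)) - of_bool (\<mu> (k + 1)))"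
proof -
  let ?I = "{x. \<eta> x \<and> \<not> \<mu> x}" and ?h = "\<lambda>x. 1 - q powi gap \<eta> \<mu> x"
  have fin: "finite ?I" by (rule finite_increases[OF A])
  have gk: "gap \<eta> \<mu> k = g + of_bool (\<eta> k) - of_bool (\<mu> k)"
    using gap_step[OF A, of k] by (simp add: g_def)
  have gk1: "gap \<eta> \<mu> (k + 1) = g + of_bool (\<eta> k) - of_bool (\<mu> k) + of_bool (\<eta> (k + 1)) - of_bool (\<mu> (k + 1))"
    using gap_step[OF A, of "k + 1"] gk by simp
  have "prod ?h ?I = prod ?h (?I - ?I \<inter> {k, k + 1}) * prod ?h (?I \<inter> {k, k + 1})"
    by (rule prod.subset_diff[OF Int_lower1 fin])
  also have "?I - ?I \<inter> {k, k + 1} = ?I - {k, k + 1}" by (simp only: Diff_Int Diff_cancel Un_empty_left)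
  also have "prod ?h (?I \<inter> {k, k + 1}) = f (\<eta> k) (\<mu> k) (gap \<eta> \<mu> k) * f (\<eta> (k + 1)) (\<mu> (k + 1)) (gap \<eta> \<mu> (k + 1))"
    unfolding f_def
    by (cases "\<eta> k"; cases "\<mu> k"; cases "\<eta> (k + 1)"; cases "\<mu> (k + 1)")
      (simp_all add: Int_insert_right)
  finally show ?thesis unfolding local_weight_def gk gk1 by (simp only: mult.assoc)
qed

text \<open>The coefficients depend on \<open>\<mu>\<close> and \<open>k\<close> but not on
  \<open>\<eta>\<close>, so the identities survive taking expectations. The same pair serves both
  identities although the parameters are exchanged in the second.\<close>

lemma vertex_duality:
  fixes b1 b2 :: real
  assumes b: "0 < b1" "0 < b2" and M: "\<mu> \<in> configs_A"
  shows "\<exists>\<alpha> \<beta>.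
    (\<forall>\<eta>. vertex_op b1 b2 k (\<lambda>\<zeta>. of_bool (\<zeta> = \<mu>)) \<eta> =
       \<alpha> * of_bool (\<eta> = \<mu>) + \<beta> * of_bool (\<eta> = swap_sites k \<mu>)) \<and>
    (\<forall>\<eta>\<in>configs_A. vertex_op b2 b1 k (\<lambda>\<zeta>. local_weight (b1 / b2) \<zeta> \<mu>) \<eta> =
       \<alpha> * local_weight (b1 / b2) \<eta> \<mu> + \<beta> * local_weight (b1 / b2) \<eta> (swap_sites k \<mu>))"
proof -
  define q where "q = b1 / b2"
  have q: "q \<noteq> 0" "b1 = q * b2" using b by (simp_all add: q_def)
  \<comment> \<open>Read off from the first identity: \<open>\<alpha>\<close> is the probability of
    staying at \<open>\<mu>\<close> and \<open>\<beta>\<close> that of moving to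
    \<open>\<mu>\<close> from its swap. If the two sites agree, the swap is \<open>\<mu>\<close>
    itself, whence \<open>\<beta> = 0\<close>.\<close>
  define \<alpha> where "\<alpha> = (if \<mu> k = \<mu> (k + 1) then 1 else if \<mu> k then 1 - b2 else 1 - b1)"
  define \<beta> where "\<beta> = (if \<mu> k = \<mu> (k + 1) then 0 else if \<mu> k then b1 else b2)"
  let ?s = "swap_sites k"
  let ?m = "?s \<mu>"
  have "vertex_op b1 b2 k (\<lambda>\<zeta>. of_bool (\<zeta> = \<mu>)) \<eta> = \<alpha> * of_bool (\<eta> = \<mu>) + \<beta> * of_bool (\<eta> = ?m)" for \<eta>
  proof -
    have "?s \<eta> = \<mu> \<longleftrightarrow> \<eta> = ?m" using swap_swap by metis
    moreover have "?m k = \<mu> (k + 1)" "?m (k + 1) = \<mu> k" by (simp_all add: swap_sites_apply)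
    moreover have "?m = \<mu> \<longleftrightarrow> \<mu> k = \<mu> (k + 1)" by (metis swap_sites_apply swap_sites_eq)
    ultimately show ?thesis by (auto simp: vertex_op_def \<alpha>_def \<beta>_def)
  qed
  moreover have "vertex_op b2 b1 k (\<lambda>\<zeta>. local_weight q \<zeta> \<mu>) \<eta> =
      \<alpha> * local_weight q \<eta> \<mu> + \<beta> * local_weight q \<eta> ?m" if H: "\<eta> \<in> configs_A" for \<eta>
  proof -
    let ?h = "?s \<eta>"
    have H': "?h \<in> configs_A" and M': "?m \<in> configs_A" using H M by simp_all
    define P where "P = (\<Prod>x\<in>{x. \<eta> x \<and> \<not> \<mu> x} - {k, k + 1}. 1 - q powi gap \<eta> \<mu> x)"
    have P: "(\<Prod>x\<in>{x. \<zeta> x \<and> \<not> \<nu> x} - {k, k + 1}. 1 - q powi gap \<zeta> \<nu> x) = P"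
      if "\<zeta> = \<eta> \<or> \<zeta> = ?h" "\<nu> = \<mu> \<or> \<nu> = ?m" for \<zeta> \<nu>
      unfolding P_def
    proof (rule prod.cong)
      show "{x. \<zeta> x \<and> \<not> \<nu> x} - {k, k + 1} = {x. \<eta> x \<and> \<not> \<mu> x} - {k, k + 1}"
        using that by (auto simp: swap_sites_apply)
    next
      fix x assume "x \<in> {x. \<eta> x \<and> \<not> \<mu> x} - {k, k + 1}"
      then show "1 - q powi gap \<zeta> \<nu> x = 1 - q powi gap \<eta> \<mu> x"
        using that by (auto simp: gap_def cfg_height_swap_sites)
    qed
    let ?E = "\<lambda>\<mu>. \<Sum>x | cfg_height \<mu> x \<noteq> nat x. cfg_height \<mu> x - nat x"
    define g where "g = gap \<eta> \<mu> (k - 1)"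
    have g: "gap \<zeta> \<nu> (k - 1) = g" if "\<zeta> = \<eta> \<or> \<zeta> = ?h" "\<nu> = \<mu> \<or> \<nu> = ?m" for \<zeta> \<nu>
      using that by (auto simp: g_def gap_def cfg_height_swap_sites)
    have s: "?h k = \<eta> (k + 1)" "?h (k + 1) = \<eta> k" "?m k = \<mu> (k + 1)" "?m (k + 1) = \<mu> k"
      by (simp_all add: swap_sites_apply)
    define e e' where "e = ?E \<mu>" and "e' = ?E ?m"
    note W = local_weight_two_sites[of _ _ q k]
    note W4 = W[OF H M, unfolded P[of \<eta> \<mu>, simplified] g[of \<eta> \<mu>, simplified], folded e_def]
      W[OF H M', unfolded P[of \<eta> ?m, simplified] g[of \<eta> ?m, simplified] s, folded e'_def]
      W[OF H' M, unfolded P[of ?h \<mu>, simplified] g[of ?h \<mu>, simplified] s, folded e_def]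
    \<comment> \<open>When the sites of \<open>\<mu>\<close> differ, the factors at the two sites
      involve only the exponents \<open>g\<close> and \<open>g + 1\<close>. Together with
      \<open>b1 = q * b2\<close> this reduces the cases to algebra.\<close>
    have pow: "q powi (g + 1) = q * q powi g" using q by (simp add: power_int_add_1)
    have Eup: "e' = Suc e" if "\<not> \<mu> k" "\<mu> (k + 1)"
      unfolding e_def e'_def using size_swap_sites[OF M that] .
    have Edown: "e = Suc e'" if "\<mu> k" "\<not> \<mu> (k + 1)"
    proof -
      have "\<not> ?m k" "?m (k + 1)" using that s by simp_all
      from size_swap_sites[OF M' this] show ?thesis unfolding swap_swap e_def e'_def .
    qed
    show ?thesis
    proof (cases "\<mu> k = \<mu> (k + 1)")
      case True
      then show ?thesis
        unfolding vertex_op_def \<alpha>_def \<beta>_def W4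
        by (cases "\<eta> k"; cases "\<eta> (k + 1)"; cases "\<mu> (k + 1)") (simp_all add: algebra_simps)
    next
      case False
      show ?thesis
      proof (cases "\<mu> k")
        case True
        with False have n: "\<not> \<mu> (k + 1)" by simp
        show ?thesis
          unfolding vertex_op_def \<alpha>_def \<beta>_def W4 Edown[OF True n] q(2)
          using True n pow
          by (cases "\<eta> k"; cases "\<eta> (k + 1)") (simp_all add: algebra_simps)
      next
        case no: False
        with False have n: "\<mu> (k + 1)" by simp
        show ?thesis
          unfolding vertex_op_def \<alpha>_def \<beta>_def W4 Eup[OF no n] q(2)
          using no n pow
          by (cases "\<eta> k"; cases "\<eta> (k + 1)") (simp_all add: algebra_simps)
      qed
    qed
  qed
  ultimately show ?thesis unfolding q_def[symmetric] by (intro exI conjI allI ballI)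
qed

section \<open>Sampling a line vertex by vertex\<close>

lemma up_out_iff:
  "up_out b l c \<longleftrightarrow> (b \<and> l) \<or> (b \<and> \<not> l \<and> fst c) \<or> (\<not> b \<and> l \<and> \<not> snd c)"
  by (cases c) auto

lemma right_out_iff:
  "right_out b l c \<longleftrightarrow> (b \<and> l) \<or> (b \<and> \<not> l \<and> \<not> fst c) \<or> (\<not> b \<and> l \<and> snd c)"
  by (cases c) auto

lemma left_edge_empty:
  assumes "\<forall>y<x. \<not> V y"
  shows "\<not> left_edge V s x"
proof
  assume "left_edge V s x"
  then obtain m where "m \<le> x" "left_from V s m (nat (x - m))" by (auto simp: left_edge_def)
  then show False using left_from_shift(1)[of m "nat (x - m)" V s] assms by simp
qed

lemma below_edge_step_config_empty:
  "x \<le> 0 \<Longrightarrow> \<not> below_edge C step_config \<omega> t x"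
proof (induction t arbitrary: x)
  case (Suc t)
  then have "\<forall>y<x. \<not> below_edge C step_config \<omega> t y" by simp
  then show ?case using Suc left_edge_empty by (simp add: up_out_iff)
qed (simp add: step_config_def)

definition row :: "(int \<times> nat) set \<Rightarrow> coins \<Rightarrow> nat \<Rightarrow> int \<Rightarrow> bool" where
  "row C \<omega> t x = left_edge (below_edge C step_config \<omega> t) (\<lambda>y. censor C \<omega> (y, t)) x"

lemma row_Suc:
  "row C \<omega> t (x + 1) =
     right_out (below_edge C step_config \<omega> t x) (row C \<omega> t x) (censor C \<omega> (x, t))"
  unfolding row_def
  by (rule left_edge_rec(1)) (metis below_edge_step_config_empty less_le)

lemma row_empty: "x \<le> 1 \<Longrightarrow> \<not> row C \<omega> t x"
  unfolding row_def by (intro left_edge_empty) (simp add: below_edge_step_config_empty)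

lemma below_edge_Suc_row:
  "below_edge C step_config \<omega> (Suc t) x =
     up_out (below_edge C step_config \<omega> t x) (row C \<omega> t x) (censor C \<omega> (x, t))"
  by (simp add: row_def)

text \<open>From the step configuration no path ever visits a vertex \<open>x \<le> 0\<close>, so sampling starts at \<open>x = 1\<close>.
  After \<open>n\<close> vertices of line \<open>t\<close>, site \<open>n - t\<close> holds the horizontal edge that leaves the last one.\<close>

definition stage :: "(int \<times> nat) set \<Rightarrow> coins \<Rightarrow> nat \<Rightarrow> nat \<Rightarrow> config" where
  "stage C \<omega> t n p =
     (if p < int n - int t then below_edge C step_config \<omega> (Suc t) (p + int t + 1)
      else if p = int n - int t then row C \<omega> t (int n + 1)
      else below_edge C step_config \<omega> t (p + int t))"

definition apply_vertex :: "int \<Rightarrow> bool \<times> bool \<Rightarrow> config \<Rightarrow> config" where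
  "apply_vertex k c \<eta> =
     (if \<eta> k \<noteq> \<eta> (k + 1) \<and> (if \<eta> k then snd c else fst c) then swap_sites k \<eta> else \<eta>)"

text \<open>The sites \<open>p \<le> - t\<close> hold vertical edges at \<open>x \<le> 0\<close> or
  the horizontal edge into vertex 1; all of these are empty.\<close>

lemma stage_0: "stage C \<omega> t 0 = six_vertex C step_config \<omega> t"
proof
  fix p
  consider "p < - int t" | "p = - int t" | "p > - int t" by linarith
  then show "stage C \<omega> t 0 p = six_vertex C step_config \<omega> t p"
    by cases (simp_all add: stage_def six_vertex_def below_edge_step_config_empty row_empty
        del: below_edge.simps)
qed

text \<open>With \<open>k = n - t\<close>, the upward output replaces the left input at site
  \<open>k\<close> and the right output replaces the lower input at \<open>k + 1\<close>. Hence
  going straight swaps the pair, and turning, in particular censoring, leaves it fixed.\<close>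

lemma stage_Suc:
  "stage C \<omega> t (Suc n) =
     apply_vertex (int n - int t) (censor C \<omega> (int n + 1, t)) (stage C \<omega> t n)"
proof
  fix p
  let ?k = "int n - int t" and ?c = "censor C \<omega> (int n + 1, t)"
  let ?l = "row C \<omega> t (int n + 1)" and ?b = "below_edge C step_config \<omega> t (int n + 1)"
  have sk: "stage C \<omega> t n ?k = ?l" "stage C \<omega> t n (?k + 1) = ?b"
    by (simp_all add: stage_def algebra_simps)
  consider "p < ?k" | "p = ?k" | "p = ?k + 1" | "p > ?k + 1" by linarith
  then show "stage C \<omega> t (Suc n) p = apply_vertex ?k ?c (stage C \<omega> t n) p"
  proof cases
    case 1
    then show ?thesis by (simp add: stage_def apply_vertex_def swap_sites_apply)
  next
    case 2
    have "stage C \<omega> t (Suc n) p = up_out ?b ?l ?c"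
      using 2 below_edge_Suc_row[of C \<omega> t "int n + 1"] by (simp add: stage_def)
    then show ?thesis using 2 sk by (auto simp: apply_vertex_def swap_sites_apply up_out_iff)
  next
    case 3
    have "stage C \<omega> t (Suc n) p = right_out ?b ?l ?c"
      using 3 row_Suc[of C \<omega> t "int n + 1"] by (simp add: stage_def algebra_simps)
    then show ?thesis using 3 sk by (auto simp: apply_vertex_def swap_sites_apply right_out_iff)
  next
    case 4
    then show ?thesis by (simp add: stage_def apply_vertex_def swap_sites_apply)
  qed
qed

lemma apply_vertex_configs_A: "\<eta> \<in> configs_A \<Longrightarrow> apply_vertex k c \<eta> \<in> configs_A"
  by (simp add: apply_vertex_def)

lemma stage_configs_A:
  assumes "six_vertex C step_config \<omega> t \<in> configs_A"
  shows "stage C \<omega> t n \<in> configs_A"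
  by (induction n) (simp_all add: stage_0 assms stage_Suc apply_vertex_configs_A)

text \<open>The line is finished once a path runs horizontally through the fully occupied part of the
  line; this needs one coin there that turns the path coming from below.\<close>

lemma stage_eventually_six_vertex:
  assumes A: "six_vertex C step_config \<omega> t \<in> configs_A"
    and turn: "\<And>Y. \<exists>x\<ge>Y. \<not> fst (\<omega> (x, t))"
  obtains N where "\<And>n. n \<ge> N \<Longrightarrow> stage C \<omega> t n = six_vertex C step_config \<omega> (Suc t)"
proof -
  let ?B = "below_edge C step_config \<omega>"
  obtain m :: nat where m: "\<forall>p>int m. six_vertex C step_config \<omega> t p"
    using configs_A_D[OF A] by metis
  have full: "?B t y" if "y > int m + int t" for y
    using m[rule_format, of "y - int t"] that by (simp add: six_vertex_def)
  obtain x where x: "x \<ge> int m + int t + 1" "\<not> fst (\<omega> (x, t))" using turn by blast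
  \<comment> \<open>Even if \<open>(x, t)\<close> is censored the path from below turns, and if a
    path also comes from the left the right edge is occupied anyway.\<close>
  have "row C \<omega> t (x + 1)"
    using full[of x] x by (simp add: row_Suc right_out_iff censor_def)
  \<comment> \<open>From here on both incoming edges are occupied at every vertex, so the coins no
    longer matter.\<close>
  then have row: "row C \<omega> t (x + 1 + int i)" for i
  proof (induction i)
    case (Suc i)
    have "row C \<omega> t (x + 1 + int i + 1)"
      using Suc full[of "x + 1 + int i"] x by (subst row_Suc) (simp add: right_out_iff)
    then show ?case by (simp add: algebra_simps)
  qed simp
  have row: "row C \<omega> t y" if "y \<ge> x + 1" for y
    using row[of "nat (y - (x + 1))"] that by simp
  have up: "?B (Suc t) y" if "y \<ge> x + 1" for y
    using row[OF that] full[of y] that x by (subst below_edge_Suc_row) (simp add: up_out_iff)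
  have "stage C \<omega> t n p = six_vertex C step_config \<omega> (Suc t) p" if n: "n \<ge> nat x" for n p
  proof -
    have S: "six_vertex C step_config \<omega> (Suc t) p = ?B (Suc t) (p + int t + 1)"
      by (simp add: six_vertex_def algebra_simps del: below_edge.simps)
    consider "p < int n - int t" | "p = int n - int t" | "p > int n - int t" by linarith
    then show ?thesis
    proof cases
      case 1
      then show ?thesis unfolding S by (simp add: stage_def del: below_edge.simps)
    next
      case 2
      then show ?thesis
        unfolding S using up[of "p + int t + 1"] row[of "int n + 1"] n
        by (simp add: stage_def del: below_edge.simps)
    next
      case 3
      then show ?thesis
        unfolding S using up[of "p + int t + 1"] full[of "p + int t"] n x
        by (simp add: stage_def del: below_edge.simps)
    qed
  qed
  then show ?thesis using that by blast
qed

lemma step_config_in_configs_A: "step_config \<in> configs_A"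
proof -
  have empty: "{x. x \<le> 0 \<and> step_config x} = {}" "{x. x \<ge> 1 \<and> \<not> step_config x} = {}"
    by (auto simp: step_config_def)
  show ?thesis unfolding configs_A_def mem_Collect_eq empty by simp
qed

text \<open>On this event each line amounts to finitely many swaps, which preserve
  \<open>configs_A\<close>.\<close>

lemma six_vertex_configs_A:
  assumes "\<And>t Y. \<exists>x\<ge>Y. \<not> fst (\<omega> (x, t))"
  shows "six_vertex C step_config \<omega> t \<in> configs_A"
proof (induction t)
  case 0
  then show ?case by (simp add: six_vertex_def[abs_def] step_config_in_configs_A)
next
  case (Suc t)
  obtain N where "\<And>n. n \<ge> N \<Longrightarrow> stage C \<omega> t n = six_vertex C step_config \<omega> (Suc t)"
    using stage_eventually_six_vertex[OF Suc] assms by metis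
  from this[of N] show ?case using stage_configs_A[OF Suc, of N] by simp
qed

lemma below_edge_cong_coins:
  "(\<And>x s. s < t \<Longrightarrow> \<omega> (x, s) = \<omega>' (x, s)) \<Longrightarrow> below_edge C \<eta> \<omega> t = below_edge C \<eta> \<omega>' t"
proof (induction t)
  case (Suc t)
  have "censor C \<omega> (y, t) = censor C \<omega>' (y, t)" for y
    using Suc.prems by (simp add: censor_def)
  moreover have "below_edge C \<eta> \<omega> t = below_edge C \<eta> \<omega>' t" using Suc by simp
  ultimately show ?case by simp
qed simp

text \<open>The first \<open>n\<close> vertices of a line use only coins of earlier lines and their
  own, so the state before vertex \<open>m + 1\<close> is independent of the coin there.\<close>

lemma stage_fun_upd:
  assumes v: "v = (int m + 1, t)" and "n \<le> m"
  shows "stage C (fun_upd \<omega> v c) t n = stage C \<omega> t n"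
  using assms(2)
proof (induction n)
  case 0
  have "below_edge C step_config (fun_upd \<omega> v c) t = below_edge C step_config \<omega> t"
    by (rule below_edge_cong_coins) (simp add: v)
  then show ?case unfolding stage_0 by (intro ext) (simp only: six_vertex_def)
next
  case (Suc n)
  then show ?case by (simp add: stage_Suc censor_def v)
qed

section \<open>Expectations over the coins\<close>

lemma space_coin_measure [simp]: "space (coin_measure a b) = UNIV"
  by (simp add: coin_measure_def space_PiM)

lemma prob_space_coin_measure: "prob_space (coin_measure a b)"
  unfolding coin_measure_def by (intro prob_space_PiM prob_space_measure_pmf)

lemma measurable_coin [measurable]: "(\<lambda>\<omega>. \<omega> v) \<in> coin_measure a b \<rightarrow>\<^sub>M count_space UNIV"
proof -
  have "(\<lambda>\<omega>. \<omega> v) \<in> coin_measure a b \<rightarrow>\<^sub>M measure_pmf (pair_pmf (bernoulli_pmf a) (bernoulli_pmf b))"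
    unfolding coin_measure_def by (rule measurable_component_singleton) simp
  then show ?thesis unfolding measurable_def by simp
qed

lemma measurable_censor [measurable]:
  "Measurable.pred (coin_measure a b) (\<lambda>\<omega>. fst (censor C \<omega> v))"
  "Measurable.pred (coin_measure a b) (\<lambda>\<omega>. snd (censor C \<omega> v))"
proof -
  have "Measurable.pred (coin_measure a b) (\<lambda>\<omega>. f (\<omega> v))" for f :: "bool \<times> bool \<Rightarrow> bool"
    by (rule measurable_compose[OF measurable_coin measurable_count_space])
  from this[of "\<lambda>c. fst (if v \<in> C then (False, False) else c)"]
    this[of "\<lambda>c. snd (if v \<in> C then (False, False) else c)"]
  show "Measurable.pred (coin_measure a b) (\<lambda>\<omega>. fst (censor C \<omega> v))"
    "Measurable.pred (coin_measure a b) (\<lambda>\<omega>. snd (censor C \<omega> v))"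
    unfolding censor_def by blast+
qed

lemma measurable_left_edge:
  assumes [measurable]: "\<And>x. Measurable.pred M (\<lambda>\<omega>. V \<omega> x)"
    "\<And>x. Measurable.pred M (\<lambda>\<omega>. fst (s \<omega> x))" "\<And>x. Measurable.pred M (\<lambda>\<omega>. snd (s \<omega> x))"
  shows "Measurable.pred M (\<lambda>\<omega>. left_edge (V \<omega>) (s \<omega>) x)"
proof -
  have [measurable]: "Measurable.pred M (\<lambda>\<omega>. left_from (V \<omega>) (s \<omega>) m n)" for m n
  proof (induction n)
    case (Suc n)
    then show ?case
      unfolding left_from.simps right_out_iff by (intro pred_intros_logic assms)
  qed simp
  show ?thesis unfolding left_edge_def by measurable
qed

lemma measurable_below_edge [measurable]:
  "Measurable.pred (coin_measure a b) (\<lambda>\<omega>. below_edge C \<eta> \<omega> t x)"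
proof (induction t arbitrary: x)
  case (Suc t)
  have "Measurable.pred (coin_measure a b)
      (\<lambda>\<omega>. left_edge (below_edge C \<eta> \<omega> t) (\<lambda>y. censor C \<omega> (y, t)) x)"
    by (intro measurable_left_edge Suc measurable_censor)
  with Suc show ?case
    unfolding below_edge.simps up_out_iff by (intro pred_intros_logic measurable_censor)
qed simp

lemma measurable_row [measurable]: "Measurable.pred (coin_measure a b) (\<lambda>\<omega>. row C \<omega> t x)"
  unfolding row_def by (intro measurable_left_edge measurable_below_edge measurable_censor)

lemma measurable_six_vertex [measurable]:
  "Measurable.pred (coin_measure a b) (\<lambda>\<omega>. six_vertex C \<eta> \<omega> t p)"
  unfolding six_vertex_def by (rule measurable_below_edge)

lemma measurable_stage [measurable]:
  "Measurable.pred (coin_measure a b) (\<lambda>\<omega>. stage C \<omega> t n p)"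
proof -
  consider "p < int n - int t" | "p = int n - int t" | "p > int n - int t" by linarith
  then show ?thesis
  proof cases
    case 1
    then have "stage C \<omega> t n p = below_edge C step_config \<omega> (Suc t) (p + int t + 1)" for \<omega>
      unfolding stage_def by (rule if_P)
    then show ?thesis by (simp only: measurable_below_edge)
  next
    case 2
    then have "stage C \<omega> t n p = row C \<omega> t (int n + 1)" for \<omega> by (simp add: stage_def)
    then show ?thesis by (simp only: measurable_row)
  next
    case 3
    then have "stage C \<omega> t n p = below_edge C step_config \<omega> t (p + int t)" for \<omega>
      by (simp add: stage_def)
    then show ?thesis by (simp only: measurable_below_edge)
  qed
qed

text \<open>No sigma-algebra on configurations is used. Recording \<open>X\<close> inside the
  countable set \<open>configs_A\<close> and \<open>None\<close> outside gives a discrete random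
  variable, through which \<open>F\<close> factors because it vanishes off
  \<open>configs_A\<close>.\<close>

lemma measurable_config_functional:
  fixes F :: "config \<Rightarrow> real"
  assumes [measurable]: "\<And>p. Measurable.pred M (\<lambda>\<omega>. X \<omega> p)"
    and F: "\<And>\<zeta>. \<zeta> \<notin> configs_A \<Longrightarrow> F \<zeta> = 0"
  shows "(\<lambda>\<omega>. F (X \<omega>)) \<in> borel_measurable M"
proof -
  define g where "g \<omega> = (if X \<omega> \<in> configs_A then Some (X \<omega>) else None)" for \<omega>
  have pt: "Measurable.pred M (\<lambda>\<omega>. X \<omega> = \<zeta>)" for \<zeta>
    unfolding fun_eq_iff by measurable
  have A: "Measurable.pred M (\<lambda>\<omega>. X \<omega> \<in> configs_A)"
  proof -
    have "{\<omega> \<in> space M. X \<omega> \<in> configs_A} = (\<Union>\<zeta>\<in>configs_A. {\<omega> \<in> space M. X \<omega> = \<zeta>})" by auto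
    also have "\<dots> \<in> sets M"
      using countable_configs_A pt by (intro sets.countable_UN') (auto simp: pred_def)
    finally show ?thesis by (simp add: pred_def)
  qed
  have "g \<in> M \<rightarrow>\<^sub>M count_space (insert None (Some ` configs_A))"
  proof (subst measurable_count_space_eq_countable)
    show "countable (insert None (Some ` configs_A))" using countable_configs_A by simp
    have "g -` {z} \<inter> space M \<in> sets M" if "z \<in> insert None (Some ` configs_A)" for z
    proof (cases z)
      case None
      then have "g -` {z} \<inter> space M = {\<omega> \<in> space M. \<not> X \<omega> \<in> configs_A}" by (auto simp: g_def)
      then show ?thesis using A by simp
    next
      case (Some \<zeta>)
      then have "g -` {z} \<inter> space M = {\<omega> \<in> space M. X \<omega> = \<zeta>}" using that
        by (auto simp: g_def split: if_splits)
      then show ?thesis using pt by simp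
    qed
    then show "g \<in> space M \<rightarrow> insert None (Some ` configs_A) \<and>
        (\<forall>z\<in>insert None (Some ` configs_A). g -` {z} \<inter> space M \<in> sets M)"
      by (auto simp: g_def)
  qed
  then have "(\<lambda>\<omega>. case_option 0 F (g \<omega>)) \<in> borel_measurable M"
    by (rule measurable_compose) simp
  moreover have "case_option 0 F (g \<omega>) = F (X \<omega>)" for \<omega> using F by (simp add: g_def)
  ultimately show ?thesis by simp
qed

section \<open>Averaging over a coin and reaching the end of a line\<close>

lemma expectation_bernoulli_pair:
  fixes H :: "bool \<times> bool \<Rightarrow> real"
  assumes "0 \<le> a" "a \<le> 1" "0 \<le> b" "b \<le> 1"
  shows "(\<integral>c. H c \<partial>measure_pmf (pair_pmf (bernoulli_pmf a) (bernoulli_pmf b))) =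
    a * b * H (True, True) + a * (1 - b) * H (True, False) +
    (1 - a) * b * H (False, True) + (1 - a) * (1 - b) * H (False, False)"
proof -
  have U: "(UNIV :: (bool \<times> bool) set) = {(True, True), (True, False), (False, True), (False, False)}"
    by auto
  show ?thesis
    using assms by (subst integral_measure_pmf_real[of UNIV]) (auto simp: U pmf_pair)
qed

text \<open>Overwriting one coordinate by an independent copy preserves the product measure; Fubini
  then lets that coin be averaged with all the others fixed.\<close>

lemma integral_coin_resample:
  fixes f :: "coins \<Rightarrow> real"
  assumes f [measurable]: "f \<in> borel_measurable (coin_measure a b)" and bnd: "\<And>\<omega>. \<bar>f \<omega>\<bar> \<le> B"
  shows "(\<integral>\<omega>. f \<omega> \<partial>coin_measure a b) =
    (\<integral>\<omega>. (\<integral>c. f (fun_upd \<omega> v c) \<partial>measure_pmf (pair_pmf (bernoulli_pmf a) (bernoulli_pmf b))) \<partial>coin_measure a b)"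
proof -
  let ?p = "measure_pmf (pair_pmf (bernoulli_pmf a) (bernoulli_pmf b))"
  let ?M = "coin_measure a b"
  let ?u = "\<lambda>(c, \<omega>). fun_upd \<omega> v c"
  interpret M: prob_space ?M by (rule prob_space_coin_measure)
  interpret p: prob_space ?p by (rule prob_space_measure_pmf)
  interpret pair_prob_space ?p ?M ..
  have d: "distr (?p \<Otimes>\<^sub>M ?M) ?M ?u = ?M"
    using distr_pair_PiM_eq_PiM[of UNIV "\<lambda>_. ?p" v]
    unfolding coin_measure_def by (simp add: prob_space_measure_pmf)
  have m: "?u \<in> ?p \<Otimes>\<^sub>M ?M \<rightarrow>\<^sub>M ?M"
    unfolding coin_measure_def case_prod_beta
    by (rule measurable_fun_upd[where J = UNIV]) auto
  have "(\<integral>\<omega>. f \<omega> \<partial>?M) = (\<integral>\<omega>. f \<omega> \<partial>distr (?p \<Otimes>\<^sub>M ?M) ?M ?u)" by (simp only: d)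
  also have "\<dots> = (\<integral>x. f (?u x) \<partial>(?p \<Otimes>\<^sub>M ?M))" by (rule integral_distr[OF m f])
  also have "\<dots> = (\<integral>x. (case x of (c, \<omega>) \<Rightarrow> f (fun_upd \<omega> v c)) \<partial>(?p \<Otimes>\<^sub>M ?M))"
    by (simp add: case_prod_beta)
  also have "\<dots> = (\<integral>\<omega>. (\<integral>c. f (fun_upd \<omega> v c) \<partial>?p) \<partial>?M)"
  proof (rule integral_snd[symmetric])
    have "(\<lambda>x. f (?u x)) \<in> borel_measurable (?p \<Otimes>\<^sub>M ?M)" using measurable_compose[OF m f] .
    then show "integrable (?p \<Otimes>\<^sub>M ?M) (\<lambda>(c, \<omega>). f (fun_upd \<omega> v c))"
      by (intro integrable_const_bound[of _ B]) (auto simp: bnd case_prod_beta)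
  qed
  finally show ?thesis .
qed

text \<open>The stage after \<open>n\<close> vertices ignores the coin of vertex
  \<open>n + 1\<close>, so averaging over that coin alone produces \<open>vertex_op\<close>; a
  censored vertex does nothing.\<close>

lemma expectation_stage_Suc:
  fixes G :: "config \<Rightarrow> real"
  assumes ab: "0 \<le> a" "a \<le> 1" "0 \<le> b" "b \<le> 1"
    and G: "\<And>\<zeta>. \<zeta> \<notin> configs_A \<Longrightarrow> G \<zeta> = 0" "\<And>\<zeta>. \<bar>G \<zeta>\<bar> \<le> B"
  shows "(\<integral>\<omega>. G (stage C \<omega> t (Suc n)) \<partial>coin_measure a b) =
    (\<integral>\<omega>. (if (int n + 1, t) \<in> C then G (stage C \<omega> t n)
          else vertex_op a b (int n - int t) G (stage C \<omega> t n)) \<partial>coin_measure a b)"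
proof (cases "(int n + 1, t) \<in> C")
  case True
  then have "stage C \<omega> t (Suc n) = stage C \<omega> t n" for \<omega>
    by (auto simp: stage_Suc censor_def apply_vertex_def)
  then show ?thesis using True by simp
next
  case False
  let ?k = "int n - int t"
  let ?p = "measure_pmf (pair_pmf (bernoulli_pmf a) (bernoulli_pmf b))"
  define v where "v = (int n + 1, t)"
  have "(\<integral>\<omega>. G (stage C \<omega> t (Suc n)) \<partial>coin_measure a b) =
    (\<integral>\<omega>. (\<integral>c. G (stage C (fun_upd \<omega> v c) t (Suc n)) \<partial>?p) \<partial>coin_measure a b)"
    by (intro integral_coin_resample[where B = B] measurable_config_functional G) measurable
  also have "(\<lambda>\<omega>. \<integral>c. G (stage C (fun_upd \<omega> v c) t (Suc n)) \<partial>?p) =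
    (\<lambda>\<omega>. vertex_op a b ?k G (stage C \<omega> t n))"
  proof
    fix \<omega>
    have "stage C (fun_upd \<omega> v c) t (Suc n) = apply_vertex ?k c (stage C \<omega> t n)" for c
      using False stage_fun_upd[OF v_def, of n C \<omega> c] by (simp add: stage_Suc censor_def v_def)
    then show "(\<integral>c. G (stage C (fun_upd \<omega> v c) t (Suc n)) \<partial>?p) = vertex_op a b ?k G (stage C \<omega> t n)"
      using ab by (simp add: expectation_bernoulli_pair apply_vertex_def vertex_op_def algebra_simps)
  qed
  finally show ?thesis using False by simp
qed

text \<open>A block of \<open>m\<close> coins that all go straight from below has probability
  \<open>a ^ m\<close>, which tends to 0; the countably many pairs \<open>(t, Y)\<close> are then
  combined.\<close>

lemma AE_turning_coins:
  assumes "0 \<le> a" "a < 1"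
  shows "AE \<omega> in coin_measure a b. \<forall>t Y. \<exists>x\<ge>Y. \<not> fst (\<omega> (x, t))"
proof -
  let ?p = "measure_pmf (pair_pmf (bernoulli_pmf a) (bernoulli_pmf b))"
  interpret P: product_prob_space "\<lambda>_ :: int \<times> nat. ?p" UNIV
    by (intro product_prob_spaceI prob_space_measure_pmf)
  have "AE \<omega> in coin_measure a b. \<exists>x\<ge>Y. \<not> fst (\<omega> (x, t))" for t Y
  proof -
    let ?E = "\<lambda>m. {\<omega> \<in> space (Pi\<^sub>M UNIV (\<lambda>_. ?p)). \<forall>v\<in>{Y..<Y + int m} \<times> {t}. \<omega> v \<in> {c. fst c}}"
    let ?N = "{\<omega> \<in> space (coin_measure a b). \<not> (\<exists>x\<ge>Y. \<not> fst (\<omega> (x, t)))}"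
    have "emeasure ?p {c. fst c} = emeasure (map_pmf fst (pair_pmf (bernoulli_pmf a) (bernoulli_pmf b))) {True}"
      by (simp add: vimage_def)
    also have "\<dots> = ennreal a"
      unfolding map_fst_pair_pmf using assms by (simp add: emeasure_pmf_single)
    finally have a: "emeasure ?p {c. fst c} = ennreal a" .
    have E: "emeasure (coin_measure a b) (?E m) = ennreal (a ^ m)" for m
    proof -
      have "emeasure (Pi\<^sub>M UNIV (\<lambda>_. ?p)) (?E m) =
        (\<Prod>v\<in>{Y..<Y + int m} \<times> {t}. emeasure ?p {c. fst c})"
        by (rule P.emeasure_PiM_Collect) auto
      also have "\<dots> = ennreal (a ^ m)"
        using assms by (simp add: a card_cartesian_product ennreal_power)
      finally show ?thesis by (simp add: coin_measure_def)
    qed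
    have N [measurable]: "?N \<in> sets (coin_measure a b)"
    proof -
      have [measurable]: "Measurable.pred (coin_measure a b) (\<lambda>\<omega>. fst (\<omega> (x, t)))" for x
        by (rule measurable_compose[OF measurable_coin]) simp
      show ?thesis by measurable
    qed
    have le: "emeasure (coin_measure a b) ?N \<le> ennreal (a ^ m)" for m
      unfolding E[symmetric]
    proof (rule emeasure_mono)
      show "?N \<subseteq> ?E m" by (auto simp: coin_measure_def space_PiM)
      show "?E m \<in> sets (coin_measure a b)"
        unfolding coin_measure_def
      proof (rule sets.sets_Collect_finite_All)
        show "{\<omega> \<in> space (Pi\<^sub>M UNIV (\<lambda>_. ?p)). \<omega> v \<in> {c. fst c}} \<in> sets (Pi\<^sub>M UNIV (\<lambda>_. ?p))" for v
          using measurable_sets[OF measurable_component_singleton[of v UNIV "\<lambda>_. ?p"], of "{c. fst c}"]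
          by (simp add: vimage_def Int_def conj_commute)
      qed simp
    qed
    have "(\<lambda>m. ennreal (a ^ m)) \<longlonglongrightarrow> ennreal 0"
      using assms by (intro tendsto_ennrealI LIMSEQ_power_zero) simp
    then have "emeasure (coin_measure a b) ?N \<le> ennreal 0"
      by (rule LIMSEQ_le_const) (use le in auto)
    then have "emeasure (coin_measure a b) ?N = 0" by simp
    then show ?thesis using N by (intro AE_I[of _ _ ?N]) auto
  qed
  then show ?thesis by (simp add: AE_all_countable)
qed

text \<open>Almost surely the stages are eventually constant and equal to the next line, and the
  constant \<open>B\<close> dominates.\<close>

lemma expectation_stage_tendsto:
  fixes G :: "config \<Rightarrow> real"
  assumes a: "0 \<le> a" "a < 1"
    and G: "\<And>\<zeta>. \<zeta> \<notin> configs_A \<Longrightarrow> G \<zeta> = 0" "\<And>\<zeta>. \<bar>G \<zeta>\<bar> \<le> B"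
  shows "(\<lambda>n. \<integral>\<omega>. G (stage C \<omega> t n) \<partial>coin_measure a b)
    \<longlonglongrightarrow> (\<integral>\<omega>. G (six_vertex C step_config \<omega> (Suc t)) \<partial>coin_measure a b)"
proof (rule integral_dominated_convergence[where w = "\<lambda>_. B"])
  interpret prob_space "coin_measure a b" by (rule prob_space_coin_measure)
  show "(\<lambda>\<omega>. G (six_vertex C step_config \<omega> (Suc t))) \<in> borel_measurable (coin_measure a b)"
    "(\<lambda>\<omega>. G (stage C \<omega> t n)) \<in> borel_measurable (coin_measure a b)" for n
    by (intro measurable_config_functional G measurable_six_vertex measurable_stage; assumption)+
  show "integrable (coin_measure a b) (\<lambda>_. B)" by simp
  show "AE \<omega> in coin_measure a b. norm (G (stage C \<omega> t n)) \<le> B" for n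
    using G(2) by simp
  show "AE \<omega> in coin_measure a b.
      (\<lambda>n. G (stage C \<omega> t n)) \<longlonglongrightarrow> G (six_vertex C step_config \<omega> (Suc t))"
    using AE_turning_coins[OF a, of b]
  proof eventually_elim
    case (elim \<omega>)
    then have "six_vertex C step_config \<omega> t \<in> configs_A" by (intro six_vertex_configs_A) blast
    then obtain N where "\<And>n. n \<ge> N \<Longrightarrow> stage C \<omega> t n = six_vertex C step_config \<omega> (Suc t)"
      using stage_eventually_six_vertex elim by metis
    then have "\<forall>\<^sub>F n in sequentially. G (stage C \<omega> t n) = G (six_vertex C step_config \<omega> (Suc t))"
      by (intro eventually_sequentiallyI[of N]) simp
    then show ?case by (rule tendsto_eventually)
  qed
qed

section \<open>Propagation of the duality\<close>

text \<open>Induction on the number of vertices treated. The induction hypothesis ranges over all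
  \<open>\<mu>\<close> at once, since a step at \<open>\<mu>\<close> also calls on its swap.\<close>

lemma stage_duality:
  fixes b1 b2 :: real
  assumes b: "0 < b1" "b1 < b2" "b2 < 1"
    and start: "\<And>\<mu>. \<mu> \<in> configs_A \<Longrightarrow>
      (\<integral>\<omega>. of_bool (stage C \<omega> t 0 = \<mu>) \<partial>coin_measure b1 b2) =
      (\<integral>\<omega>. v_config (b1 / b2) (stage C \<omega> t 0) (partition_of \<mu>) \<partial>coin_measure b2 b1)"
    and "\<mu> \<in> configs_A"
  shows "(\<integral>\<omega>. of_bool (stage C \<omega> t n = \<mu>) \<partial>coin_measure b1 b2) =
    (\<integral>\<omega>. v_config (b1 / b2) (stage C \<omega> t n) (partition_of \<mu>) \<partial>coin_measure b2 b1)"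
  using assms(5)
proof (induction n arbitrary: \<mu>)
  case 0
  then show ?case by (rule start)
next
  case (Suc n)
  let ?P = "coin_measure b1 b2" and ?Q = "coin_measure b2 b1" and ?k = "int n - int t"
  let ?v = "\<lambda>\<mu> \<zeta>. v_config (b1 / b2) \<zeta> (partition_of \<mu>)"
  let ?d = "\<lambda>\<mu> \<zeta> :: config. of_bool (\<zeta> = \<mu>) :: real"
  let ?m = "swap_sites ?k \<mu>"
  interpret P: prob_space ?P by (rule prob_space_coin_measure)
  interpret Q: prob_space ?Q by (rule prob_space_coin_measure)
  have q: "0 \<le> b1 / b2" "b1 / b2 \<le> 1" using b by simp_all
  have v0: "?v \<nu> \<zeta> = 0" if "\<zeta> \<notin> configs_A" for \<nu> \<zeta> using that by (simp add: v_config_def)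
  have v1: "\<bar>?v \<nu> \<zeta>\<bar> \<le> 1" for \<nu> \<zeta> by (rule abs_v_config_le_1[OF q])
  have d0: "?d \<nu> \<zeta> = 0" if "\<zeta> \<notin> configs_A" "\<nu> \<in> configs_A" for \<nu> \<zeta> using that by auto
  have d1: "\<bar>?d \<nu> \<zeta>\<bar> \<le> 1" for \<nu> \<zeta> by simp
  have int_v: "integrable ?Q (\<lambda>\<omega>. ?v \<nu> (stage C \<omega> t n))" for \<nu>
    by (intro Q.integrable_const_bound[of _ 1] measurable_config_functional v0 measurable_stage)
      (simp_all add: v1)
  have int_d: "integrable ?P (\<lambda>\<omega>. ?d \<nu> (stage C \<omega> t n))" if "\<nu> \<in> configs_A" for \<nu>
    by (intro P.integrable_const_bound[of _ 1] measurable_config_functional d0 measurable_stage)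
      (simp_all add: that)
  have stepP: "(\<integral>\<omega>. ?d \<mu> (stage C \<omega> t (Suc n)) \<partial>?P) =
    (\<integral>\<omega>. (if (int n + 1, t) \<in> C then ?d \<mu> (stage C \<omega> t n)
          else vertex_op b1 b2 ?k (?d \<mu>) (stage C \<omega> t n)) \<partial>?P)"
    by (rule expectation_stage_Suc[where B = 1 and G = "?d \<mu>"]) (use b Suc.prems d0 in simp_all)
  have stepQ: "(\<integral>\<omega>. ?v \<mu> (stage C \<omega> t (Suc n)) \<partial>?Q) =
    (\<integral>\<omega>. (if (int n + 1, t) \<in> C then ?v \<mu> (stage C \<omega> t n)
          else vertex_op b2 b1 ?k (?v \<mu>) (stage C \<omega> t n)) \<partial>?Q)"
    by (rule expectation_stage_Suc[where B = 1 and G = "?v \<mu>", OF _ _ _ _ v0 v1]) (use b in simp_all)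
  show ?case
  proof (cases "(int n + 1, t) \<in> C")
    case True
    then show ?thesis using stepP stepQ Suc.IH[OF Suc.prems] by (simp only: if_True)
  next
    case False
    have "b2 > 0" using b by linarith
    then obtain \<alpha> \<beta> where dual_d: "\<forall>\<eta>. vertex_op b1 b2 ?k (?d \<mu>) \<eta> = \<alpha> * ?d \<mu> \<eta> + \<beta> * ?d ?m \<eta>"
      and dual_w: "\<forall>\<eta>\<in>configs_A. vertex_op b2 b1 ?k (\<lambda>\<zeta>. local_weight (b1 / b2) \<zeta> \<mu>) \<eta> =
         \<alpha> * local_weight (b1 / b2) \<eta> \<mu> + \<beta> * local_weight (b1 / b2) \<eta> ?m"
      using vertex_duality[OF b(1) _ Suc.prems, of b2 ?k] by blast
    have m: "?m \<in> configs_A" using Suc.prems by simp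
    \<comment> \<open>Outside \<open>configs_A\<close> both sides are 0, so the identity holds for
      every configuration and can be integrated with no almost-sure restriction.\<close>
    have dual_v: "vertex_op b2 b1 ?k (?v \<mu>) \<eta> = \<alpha> * ?v \<mu> \<eta> + \<beta> * ?v ?m \<eta>" for \<eta>
    proof (cases "\<eta> \<in> configs_A")
      case True
      note w = v_config_eq_local_weight[of _ _ "b1 / b2"]
      have "vertex_op b2 b1 ?k (?v \<mu>) \<eta> = vertex_op b2 b1 ?k (\<lambda>\<zeta>. local_weight (b1 / b2) \<zeta> \<mu>) \<eta>"
        unfolding vertex_op_def using True Suc.prems by (simp only: w swap_sites_configs_A_iff)
      also have "\<dots> = \<alpha> * ?v \<mu> \<eta> + \<beta> * ?v ?m \<eta>"
        unfolding w[OF True Suc.prems] w[OF True m] using dual_w True by blast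
      finally show ?thesis .
    next
      case False
      then show ?thesis by (simp add: vertex_op_def v_config_def)
    qed
    have "(\<integral>\<omega>. ?d \<mu> (stage C \<omega> t (Suc n)) \<partial>?P) =
        (\<integral>\<omega>. \<alpha> * ?d \<mu> (stage C \<omega> t n) + \<beta> * ?d ?m (stage C \<omega> t n) \<partial>?P)"
      unfolding stepP dual_d[rule_format] using False by (simp only: if_False)
    also have "\<dots> = \<alpha> * (\<integral>\<omega>. ?d \<mu> (stage C \<omega> t n) \<partial>?P) + \<beta> * (\<integral>\<omega>. ?d ?m (stage C \<omega> t n) \<partial>?P)"
      using int_d[OF Suc.prems] int_d[OF m] by (subst Bochner_Integration.integral_add) auto
    also have "\<dots> = \<alpha> * (\<integral>\<omega>. ?v \<mu> (stage C \<omega> t n) \<partial>?Q) + \<beta> * (\<integral>\<omega>. ?v ?m (stage C \<omega> t n) \<partial>?Q)"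
      unfolding Suc.IH[OF Suc.prems] Suc.IH[OF m] by (rule refl)
    also have "\<dots> = (\<integral>\<omega>. \<alpha> * ?v \<mu> (stage C \<omega> t n) + \<beta> * ?v ?m (stage C \<omega> t n) \<partial>?Q)"
      using int_v[of \<mu>] int_v[of ?m] by (subst Bochner_Integration.integral_add) auto
    also have "\<dots> = (\<integral>\<omega>. ?v \<mu> (stage C \<omega> t (Suc n)) \<partial>?Q)"
      unfolding stepQ dual_v using False by (simp only: if_False)
    finally show ?thesis .
  qed
qed

lemma cfg_height_step_config: "cfg_height step_config x = nat x"
proof -
  have "{y. y \<le> x \<and> step_config y} = {1..x}" by (auto simp: step_config_def)
  then show ?thesis by (simp add: cfg_height_def)
qed

text \<open>Base case in time: the step configuration has the smallest height function in
  \<open>configs_A\<close>, so against any other \<open>\<mu>\<close> the gap is negative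
  somewhere.\<close>

lemma local_weight_step_config:
  assumes M: "\<mu> \<in> configs_A"
  shows "local_weight q step_config \<mu> = of_bool (step_config = \<mu>)"
proof (cases "step_config = \<mu>")
  case True
  then show ?thesis by (simp add: local_weight_def flip: cfg_height_step_config)
next
  case False
  then obtain x where "cfg_height step_config x \<noteq> cfg_height \<mu> x"
    using config_eq_if_cfg_height_eq[OF step_config_in_configs_A M] by blast
  then have "nat x < cfg_height \<mu> x"
    using cfg_height_ge_A[OF M, of x] unfolding cfg_height_step_config by linarith
  then have "gap step_config \<mu> x < 0" unfolding gap_def cfg_height_step_config by linarith
  then show ?thesis using local_weight_eq_0[OF step_config_in_configs_A M] False by simp
qed

text \<open>Induction on time: stage 0 of a line is the configuration reached so far, equality holds
  at each stage, and both sides converge to those for the next line.\<close>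

lemma six_vertex_duality:
  fixes b1 b2 :: real
  assumes b: "0 < b1" "b1 < b2" "b2 < 1" and "\<mu> \<in> configs_A"
  shows "(\<integral>\<omega>. of_bool (six_vertex C step_config \<omega> t = \<mu>) \<partial>coin_measure b1 b2) =
    (\<integral>\<omega>. v_config (b1 / b2) (six_vertex C step_config \<omega> t) (partition_of \<mu>) \<partial>coin_measure b2 b1)"
  using assms(4)
proof (induction t arbitrary: \<mu>)
  case 0
  interpret P: prob_space "coin_measure b1 b2" by (rule prob_space_coin_measure)
  interpret Q: prob_space "coin_measure b2 b1" by (rule prob_space_coin_measure)
  have "six_vertex C step_config \<omega> 0 = step_config" for \<omega>
    by (rule ext) (simp add: six_vertex_def)
  then show ?case
    using v_config_eq_local_weight[OF step_config_in_configs_A 0] local_weight_step_config[OF 0]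
      P.prob_space Q.prob_space by simp
next
  case (Suc t)
  let ?v = "\<lambda>\<zeta>. v_config (b1 / b2) \<zeta> (partition_of \<mu>)"
  have "(\<lambda>n. \<integral>\<omega>. (of_bool (stage C \<omega> t n = \<mu>) :: real) \<partial>coin_measure b1 b2) \<longlonglongrightarrow>
    (\<integral>\<omega>. of_bool (six_vertex C step_config \<omega> (Suc t) = \<mu>) \<partial>coin_measure b1 b2)"
    by (rule expectation_stage_tendsto[where G = "\<lambda>\<zeta>. of_bool (\<zeta> = \<mu>)" and B = 1])
      (use b Suc.prems in auto)
  moreover have "(\<lambda>n. \<integral>\<omega>. ?v (stage C \<omega> t n) \<partial>coin_measure b2 b1) \<longlonglongrightarrow>
    (\<integral>\<omega>. ?v (six_vertex C step_config \<omega> (Suc t)) \<partial>coin_measure b2 b1)"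
  proof (rule expectation_stage_tendsto[where B = 1])
    show "?v \<zeta> = 0" if "\<zeta> \<notin> configs_A" for \<zeta> using that by (simp add: v_config_def)
    show "\<bar>?v \<zeta>\<bar> \<le> 1" for \<zeta> using b by (intro abs_v_config_le_1) simp_all
  qed (use b in simp_all)
  moreover have "(\<integral>\<omega>. of_bool (stage C \<omega> t n = \<mu>) \<partial>coin_measure b1 b2) =
    (\<integral>\<omega>. ?v (stage C \<omega> t n) \<partial>coin_measure b2 b1)" for n
    by (rule stage_duality[OF b _ Suc.prems]) (unfold stage_0, rule Suc.IH)
  ultimately show ?case using LIMSEQ_unique by simp
qed

theorem theorem4p1:
  fixes b1 b2 :: real and C :: "(int \<times> nat) set" and t :: nat and \<mu> :: "nat \<Rightarrow> nat"
  assumes "0 < b1" and "b1 < b2" and "b2 < 1"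
    and "is_partition \<mu>"
  shows "\<P>(\<omega> in coin_measure b1 b2. six_vertex C step_config \<omega> t \<in> configs_A \<and>
             partition_of (six_vertex C step_config \<omega> t) = \<mu>) =
         (\<integral>\<omega>. v_config (b1 / b2) (six_vertex C step_config \<omega> t) \<mu> \<partial>coin_measure b2 b1)"
proof -
  obtain \<eta> where \<eta>: "\<eta> \<in> configs_A" "partition_of \<eta> = \<mu>"
    by (rule ex_config_of_partition[OF assms(4)])
  let ?E = "{\<omega> \<in> space (coin_measure b1 b2). six_vertex C step_config \<omega> t = \<eta>}"
  \<comment> \<open>The identification with partitions is injective on \<open>configs_A\<close>, so
    the event singles out one configuration.\<close>
  have "\<zeta> \<in> configs_A \<and> partition_of \<zeta> = \<mu> \<longleftrightarrow> \<zeta> = \<eta>" for \<zeta>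
    using \<eta> partition_of_eq_iff by blast
  then have "\<P>(\<omega> in coin_measure b1 b2. six_vertex C step_config \<omega> t \<in> configs_A \<and>
      partition_of (six_vertex C step_config \<omega> t) = \<mu>) = measure (coin_measure b1 b2) ?E"
    by (simp only:)
  also have "\<dots> = (\<integral>\<omega>. indicator ?E \<omega> \<partial>coin_measure b1 b2)" by simp
  also have "\<dots> = (\<integral>\<omega>. of_bool (six_vertex C step_config \<omega> t = \<eta>) \<partial>coin_measure b1 b2)"
    by (intro Bochner_Integration.integral_cong) (auto simp: indicator_def)
  also have "\<dots> = (\<integral>\<omega>. v_config (b1 / b2) (six_vertex C step_config \<omega> t) \<mu> \<partial>coin_measure b2 b1)"
    using six_vertex_duality[OF assms(1-3) \<eta>(1)] \<eta>(2) by simp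
  finally show ?thesis .
qed

end
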